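(* Let $r\ge0$, $\beta>0$, $\eta\in(0,1)$ with $0<\beta+\eta<1$, let $\omega:[-r,0]\to\mathbb{R}$ be continuous, and let $f:[0,1]\times\mathbb{R}\times\mathbb{R}\to[0,\infty)$ and $\sigma:[0,1]\to[-r,1]$ be continuous. Let $[a,b]\subset(0,\beta+\eta)\subset(0,1)$ and let $c=c_1$, where $$c_1=\begin{cases}\min\Bigl\{\dfrac{a\beta}{\beta+\eta},\dfrac{\beta+\eta-b}{\beta+\eta}\Bigr\}, & \text{if }\beta+\eta\ge\frac12,\\[2mm] \min\Bigl\{\dfrac{a\beta}{1-(\beta+\eta)},\dfrac{\beta+\eta-b}{1-(\beta+\eta)}\Bigr\}, & \text{if }\beta+\eta<\frac12.\end{cases}$$ Let $k,\gamma,\psi$ and the sets $K_\psi$, $K_{\psi,\rho}$ (built with this $c$) be as defined in the context. Let $\rho\in(0,+\infty)$ and assume that the following conditions hold. (a) There exists a continuous function $\underline{\delta}_\rho:[0,1]\to[0,\infty)$ such that $$f(t,u,v)\ge\underline{\delta}_\rho(t)\quad\text{for every } t\in[a,b]\text{ and all } u,v\in\mathbb{R}\text{ with }\max\{|u|,|v|\}\le\rho+\|\psi\|_{[-r,1]}.$$ (b) $B:\overline{K}_{\psi,\rho}\to[0,\infty)$ is continuous and bounded, and $\underline{\eta}_\rho\in[0,+\infty)$ is such that $$B[u]\ge\underline{\eta}_\rho\quad\text{for every } u\in\partial K_{\psi,\rho}.$$ (c) The inequality $$\sup_{t\in[a,b]}\Bigl\{\gamma(t)\,\underline{\eta}_\rho+\int_a^b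 k(t,s)\,\underline{\delta}_\rho(s)\,ds\Bigr\}>0$$ holds. Then there exist $\lambda_\rho\in(0,+\infty)$ and $u_\rho\in\partial K_{\psi,\rho}$ such that $u_\rho$ is a solution, with $\lambda=\lambda_\rho$, of the boundary value problem $$\begin{cases}u''(t)+\lambda f(t,u(t),u(\sigma(t)))=0, & t\in[0,1],\\ u(t)=\omega(t), & t\in[-r,0],\\ \beta u'(1)+u(\eta)=\lambda B[u],\end{cases}$$ where "solution" is understood in the sense of the associated integral equation given in the context.
   Context: For a compact interval $I\subset\mathbb{R}$, $C(I,\mathbb{R})$ is the Banach space of continuous real functions on $I$ with the supremum norm $\|u\|_I$; for a function $u$ defined on a larger interval, $\|u\|_I=\sup_{t\in I}|u(t)|$. Let $H(\tau)=1$ for $\tau\ge0$ and $H(\tau)=0$ for $\tau<0$. For $t\in[-r,1]$ and $s\in[0,1]$ define $$k(t,s)=\Bigl[\frac{\beta t}{\beta+\eta}+\frac{t}{\beta+\eta}(\eta-s)H(\eta-s)-(t-s)H(t-s)\Bigr]H(t),\qquad \gamma(t)=\frac{t}{\beta+\eta}H(t),$$ $$\psi(t)=\begin{cases}\omega(t), & -r\le t\le0,\\ \dfrac{(\beta+\eta)-t}{\beta+\eta}\,\omega(0), & 0<t\le1.\end{cases}$$ Definition of solution: a solution of the boundary value problem (for a given value of $\lambda$) is a function $u\in C([-r,1],\mathbb{R})$ satisfying $$u(t)=\psi(t)+\lambda\Bigl(\int_0^1 k(t,s)f(s,u(s),u(\sigma(s)))\,ds+\gamma(t)B[u]\Bigr)\quad\text{for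 all } t\in[-r,1].$$ Cone and translates: for the constant $c$, $$K_0=\{u\in C([-r,1],\mathbb{R}): u(t)=0\text{ for all }t\in[-r,0],\ \min_{t\in[a,b]}u(t)\ge c\|u\|_{[0,1]}\},$$ $K_\psi=\psi+K_0=\{\psi+u:u\in K_0\}$, and for $\rho>0$, $K_{0,\rho}=\{u\in K_0:\|u\|_{[0,1]}<\rho\}$ and $K_{\psi,\rho}=\psi+K_{0,\rho}$. The closure $\overline{K}_{\psi,\rho}$ and the boundary $\partial K_{\psi,\rho}$ are taken relative to $K_\psi$ (with the topology induced by the norm $\|\cdot\|_{[-r,1]}$); in particular $\partial K_{\psi,\rho}=\psi+\partial K_{0,\rho}$, where $\partial K_{0,\rho}$ is the boundary relative to $K_0$. *)

theory Defs
  imports "HOL-Analysis.Analysis"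
begin

text \<open>
  The Banach space of continuous real functions on a set S (here a compact interval) with the
  supremum metric. Its points are functions that are \<^const>\<open>undefined\<close> off S, so that equality in the
  space is equality on S, and a functional on the space sees only the values on S.
\<close>

definition C_space :: "real set \<Rightarrow> (real \<Rightarrow> real) metric" where
  "C_space S = cfunspace (top_of_set S) euclidean_metric"

definition supnorm :: "real set \<Rightarrow> (real \<Rightarrow> real) \<Rightarrow> real" where
  "supnorm I u = (SUP t\<in>I. \<bar>u t\<bar>)"

lemma mspace_C_space:
  assumes "compact S"
  shows "mspace (C_space S) = {u. continuous_on S u \<and> u \<in> extensional S}"
  using compact_continuous_image[OF _ assms, where ?'b = real]
  by (auto simp: C_space_def compact_imp_bounded)

lemma mdist_C_space:
  assumes "compact S" "S \<noteq> {}" "u \<in> mspace (C_space S)" "v \<in> mspace (C_space S)"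
  shows "mdist (C_space S) u v = supnorm S (\<lambda>t. u t - v t)"
  using assms(2-4)
  by (auto simp: C_space_def supnorm_def mdist_cfunspace_eq_mdist_funspace Met_TC.fdist_def
      Met_TC.fspace_def dist_real_def)

definition heaviside :: "real \<Rightarrow> real" where
  "heaviside \<tau> = (if \<tau> \<ge> 0 then 1 else 0)"

definition green_kernel :: "real \<Rightarrow> real \<Rightarrow> real \<Rightarrow> real \<Rightarrow> real" where
  "green_kernel \<beta> \<eta> t s =
     (\<beta> * t / (\<beta> + \<eta>) + t / (\<beta> + \<eta>) * (\<eta> - s) * heaviside (\<eta> - s)
        - (t - s) * heaviside (t - s)) * heaviside t"

definition gamma_fn :: "real \<Rightarrow> real \<Rightarrow> real \<Rightarrow> real" where
  "gamma_fn \<beta> \<eta> t = t / (\<beta> + \<eta>) * heaviside t"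

definition psi_fn :: "real \<Rightarrow> real \<Rightarrow> (real \<Rightarrow> real) \<Rightarrow> real \<Rightarrow> real" where
  "psi_fn \<beta> \<eta> \<omega> t =
     (if t \<le> 0 then \<omega> t else ((\<beta> + \<eta>) - t) / (\<beta> + \<eta>) * \<omega> 0)"

definition c1 :: "real \<Rightarrow> real \<Rightarrow> real \<Rightarrow> real \<Rightarrow> real" where
  "c1 \<beta> \<eta> a b =
     (if \<beta> + \<eta> \<ge> 1 / 2
      then min (a * \<beta> / (\<beta> + \<eta>)) ((\<beta> + \<eta> - b) / (\<beta> + \<eta>))
      else min (a * \<beta> / (1 - (\<beta> + \<eta>))) ((\<beta> + \<eta> - b) / (1 - (\<beta> + \<eta>))))"

text \<open>
  A solution, for the parameter value \<open>\<lambda>\<close>, of the boundary value problem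
  \<open>u'' + \<lambda> f(t, u(t), u(\<sigma>(t))) = 0\<close> on \<open>[0,1]\<close>, \<open>u = \<omega>\<close> on \<open>[-r,0]\<close>,
  \<open>\<beta> u'(1) + u(\<eta>) = \<lambda> B[u]\<close> is by definition a continuous solution of the associated
  integral equation.
\<close>

definition bvp_solution ::
  "real \<Rightarrow> real \<Rightarrow> real \<Rightarrow> (real \<Rightarrow> real) \<Rightarrow> (real \<Rightarrow> real \<Rightarrow> real \<Rightarrow> real) \<Rightarrow> (real \<Rightarrow> real) \<Rightarrow>
   ((real \<Rightarrow> real) \<Rightarrow> real) \<Rightarrow> real \<Rightarrow> (real \<Rightarrow> real) \<Rightarrow> bool" where
  "bvp_solution r \<beta> \<eta> \<omega> f \<sigma> B lam u \<longleftrightarrow>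
     u \<in> mspace (C_space {-r..1}) \<and>
     (\<forall>t\<in>{-r..1}.
        u t = psi_fn \<beta> \<eta> \<omega> t
          + lam * (integral {0..1} (\<lambda>s. green_kernel \<beta> \<eta> t s * f s (u s) (u (\<sigma> s)))
                   + gamma_fn \<beta> \<eta> t * B u))"

definition K0 :: "real \<Rightarrow> real \<Rightarrow> real \<Rightarrow> real \<Rightarrow> (real \<Rightarrow> real) set" where
  "K0 r a b c =
     {u \<in> mspace (C_space {-r..1}).
        (\<forall>t\<in>{-r..0}. u t = 0) \<and> (INF t\<in>{a..b}. u t) \<ge> c * supnorm {0..1} u}"

definition K0_ball :: "real \<Rightarrow> real \<Rightarrow> real \<Rightarrow> real \<Rightarrow> real \<Rightarrow> (real \<Rightarrow> real) set" where
  "K0_ball r a b c \<rho> = {u \<in> K0 r a b c. supnorm {0..1} u < \<rho>}"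

definition translate_on :: "real set \<Rightarrow> (real \<Rightarrow> real) \<Rightarrow> (real \<Rightarrow> real) set \<Rightarrow> (real \<Rightarrow> real) set" where
  "translate_on S g A = (\<lambda>u. restrict (\<lambda>t. g t + u t) S) ` A"

definition K\<psi> :: "real \<Rightarrow> real \<Rightarrow> real \<Rightarrow> real \<Rightarrow> real \<Rightarrow> real \<Rightarrow> (real \<Rightarrow> real) \<Rightarrow> (real \<Rightarrow> real) set" where
  "K\<psi> r a b c \<beta> \<eta> \<omega> = translate_on {-r..1} (psi_fn \<beta> \<eta> \<omega>) (K0 r a b c)"

definition K\<psi>_ball ::
  "real \<Rightarrow> real \<Rightarrow> real \<Rightarrow> real \<Rightarrow> real \<Rightarrow> real \<Rightarrow> (real \<Rightarrow> real) \<Rightarrow> real \<Rightarrow> (real \<Rightarrow> real) set" where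
  "K\<psi>_ball r a b c \<beta> \<eta> \<omega> \<rho> = translate_on {-r..1} (psi_fn \<beta> \<eta> \<omega>) (K0_ball r a b c \<rho>)"

definition K\<psi>_topology ::
  "real \<Rightarrow> real \<Rightarrow> real \<Rightarrow> real \<Rightarrow> real \<Rightarrow> real \<Rightarrow> (real \<Rightarrow> real) \<Rightarrow> (real \<Rightarrow> real) topology" where
  "K\<psi>_topology r a b c \<beta> \<eta> \<omega> =
     subtopology (mtopology_of (C_space {-r..1})) (K\<psi> r a b c \<beta> \<eta> \<omega>)"

definition K\<psi>_closure ::
  "real \<Rightarrow> real \<Rightarrow> real \<Rightarrow> real \<Rightarrow> real \<Rightarrow> real \<Rightarrow> (real \<Rightarrow> real) \<Rightarrow> real \<Rightarrow> (real \<Rightarrow> real) set" where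
  "K\<psi>_closure r a b c \<beta> \<eta> \<omega> \<rho> =
     K\<psi>_topology r a b c \<beta> \<eta> \<omega> closure_of K\<psi>_ball r a b c \<beta> \<eta> \<omega> \<rho>"

definition K\<psi>_boundary ::
  "real \<Rightarrow> real \<Rightarrow> real \<Rightarrow> real \<Rightarrow> real \<Rightarrow> real \<Rightarrow> (real \<Rightarrow> real) \<Rightarrow> real \<Rightarrow> (real \<Rightarrow> real) set" where
  "K\<psi>_boundary r a b c \<beta> \<eta> \<omega> \<rho> =
     K\<psi>_topology r a b c \<beta> \<eta> \<omega> frontier_of K\<psi>_ball r a b c \<beta> \<eta> \<omega> \<rho>"

end

theory Submission
  imports Defs "HOL-Complex_Analysis.Great_Picard"
begin

text \<open>
  Writing \<open>u = \<psi> + g\<close> turns the problem into \<open>g = \<lambda> F g\<close> with \<open>g\<close> in a cone and \<open>\<parallel>g\<parallel> = \<rho>\<close>, where \<open>F\<close> is compact.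
  The kernel estimates \<open>|k(t,s)| \<le> \<Phi>(s)\<close> and, for \<open>t \<in> [a,b]\<close>, \<open>k(t,s) \<ge> c \<Phi>(s)\<close> show that \<open>F\<close> maps into the cone,
  and the three hypotheses bound \<open>\<parallel>F g\<parallel>\<close> from below on the sphere. The conclusion is then the Birkhoff--Kellogg
  theorem in a cone: with a retraction \<open>R\<close> of the cone onto its sphere of radius \<open>\<rho>\<close>, Schauder's theorem gives a
  fixed point of \<open>g \<mapsto> \<rho> F(R g) / \<parallel>F(R g)\<parallel>\<close>; it lies on the sphere, so it is fixed by \<open>R\<close> and is an eigenvector.
  Schauder's theorem comes from Kuhn's combinatorial lemma, whose dimension is a natural number, so that no type
  has to be chosen for the finite-dimensional approximations.
\<close>

section \<open>Compact maps and their fixed points\<close>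

text \<open>Label each point of a grid of mesh below \<open>d\<close> by whether \<open>F\<close>
  moves its \<open>i\<close>-th coordinate up or down. Kuhn's lemma yields a cell in which both
  labels occur for every \<open>i\<close>; there \<open>F x i - x i\<close> changes sign, up to the
  variation \<open>e\<close> of \<open>F\<close> and the width \<open>d\<close> of the cell.\<close>

lemma approx_fixed_point_cube:
  fixes F :: "(nat \<Rightarrow> real) \<Rightarrow> nat \<Rightarrow> real"
  assumes F: "\<And>x i. \<forall>j<n. x j \<in> {0..1} \<Longrightarrow> i < n \<Longrightarrow> F x i \<in> {0..1}"
    and "d > 0"
    and cont: "\<And>x y i. \<forall>j<n. x j \<in> {0..1} \<Longrightarrow> \<forall>j<n. y j \<in> {0..1} \<Longrightarrow> \<forall>j<n. \<bar>x j - y j\<bar> \<le> d \<Longrightarrow>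
                 i < n \<Longrightarrow> \<bar>F x i - F y i\<bar> \<le> e"
  obtains x where "\<forall>j<n. x j \<in> {0..1}" "\<forall>i<n. \<bar>F x i - x i\<bar> \<le> e + d"
proof -
  obtain p :: nat where p: "0 < p" "1 / real p < d"
    using \<open>d > 0\<close> by (metis nat_approx_posE zero_less_Suc)
  define g where "g q j = real (q j) / real p" for q :: "nat \<Rightarrow> nat" and j
  \<comment> \<open>The clauses on \<open>q i = 0\<close> and \<open>q i \<noteq> p\<close> force
    label 0 on the lower face and label 1 on the upper face, as Kuhn's lemma demands. This agrees
    with the direction of \<open>F\<close>, because \<open>F\<close> maps into the cube.\<close>
  define label where "label q i = (if q i \<noteq> p \<and> (q i = 0 \<or> g q i \<le> F (g q) i) then 0 else 1 :: nat)" for q i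
  have gI: "\<forall>j<n. g q j \<in> {0..1}" if "\<forall>j<n. q j \<le> p" for q
    using that p by (auto simp: g_def divide_simps)
  obtain q where q: "\<forall>i<n. q i < p"
    and lab: "\<forall>i<n. \<exists>r s. (\<forall>j<n. q j \<le> r j \<and> r j \<le> q j + 1) \<and> (\<forall>j<n. q j \<le> s j \<and> s j \<le> q j + 1)
                \<and> label r i \<noteq> label s i"
    by (rule kuhn_lemma[of p n label]) (use p in \<open>auto simp: label_def\<close>)
  have step: "\<forall>j<n. g r j \<in> {0..1}" "\<forall>j<n. \<bar>g q j - g r j\<bar> \<le> d" "\<forall>j<n. g q j \<le> g r j \<and> g r j \<le> g q j + d"
    if "\<forall>j<n. q j \<le> r j \<and> r j \<le> q j + 1" for r
  proof -
    have "r j \<le> p" if "j < n" for j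
      using q \<open>\<forall>j<n. q j \<le> r j \<and> r j \<le> q j + 1\<close> that by fastforce
    then show "\<forall>j<n. g r j \<in> {0..1}" using gI by blast
    show *: "\<forall>j<n. g q j \<le> g r j \<and> g r j \<le> g q j + d"
    proof (intro allI impI)
      fix j assume "j < n"
      then have "q j \<le> r j" "real (r j) \<le> real (q j) + 1" using that by force+
      moreover from this have "g r j \<le> (real (q j) + 1) / real p"
        unfolding g_def by (intro divide_right_mono) auto
      ultimately show "g q j \<le> g r j \<and> g r j \<le> g q j + d"
        using p by (auto simp: g_def divide_right_mono add_divide_distrib)
    qed
    then show "\<forall>j<n. \<bar>g q j - g r j\<bar> \<le> d" by (auto simp: abs_le_iff)
  qed
  have gq: "\<forall>j<n. g q j \<in> {0..1}" using gI q by (simp add: less_imp_le)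
  have lab0: "g r i \<le> F (g r) i" if "label r i = 0" "i < n" "\<forall>j<n. g r j \<in> {0..1}" for r i
    using that F[of "g r" i] by (auto simp: label_def g_def split: if_splits)
  have lab1: "F (g r) i \<le> g r i" if "label r i \<noteq> 0" "i < n" "\<forall>j<n. g r j \<in> {0..1}" for r i
    using that F[of "g r" i] p by (auto simp: label_def g_def split: if_splits)
  show thesis
  proof (rule that[OF gq], intro allI impI)
    fix i assume i: "i < n"
    \<comment> \<open>The point with label 0 bounds \<open>F (g q) i\<close> from below, the one
      with label 1 from above.\<close>
    have *: "\<bar>F (g q) i - g q i\<bar> \<le> e + d"
      if r: "\<forall>j<n. q j \<le> r j \<and> r j \<le> q j + 1" and s: "\<forall>j<n. q j \<le> s j \<and> s j \<le> q j + 1"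
        and "label r i = 0" "label s i \<noteq> 0" for r s
    proof -
      have "g r i \<le> F (g r) i" "F (g s) i \<le> g s i"
        using lab0 lab1 that step(1)[OF r] step(1)[OF s] i by auto
      moreover have "\<bar>F (g q) i - F (g r) i\<bar> \<le> e" "\<bar>F (g q) i - F (g s) i\<bar> \<le> e"
        using cont gq step[OF r] step[OF s] i by auto
      moreover have "g q i \<le> g r i" "g s i \<le> g q i + d"
        using step(3)[OF r] step(3)[OF s] i by auto
      ultimately show ?thesis using \<open>d > 0\<close> by linarith
    qed
    obtain r s where rs: "\<forall>j<n. q j \<le> r j \<and> r j \<le> q j + 1" "\<forall>j<n. q j \<le> s j \<and> s j \<le> q j + 1"
      "label r i \<noteq> label s i"
      using lab i by blast
    show "\<bar>F (g q) i - g q i\<bar> \<le> e + d"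
    proof (cases "label r i = 0")
      case True
      then show ?thesis using *[OF rs(1,2)] rs(3) by auto
    next
      case False
      then have "label s i = 0" using rs(3) by (auto simp: label_def split: if_splits)
      then show ?thesis using *[OF rs(2,1)] False by auto
    qed
  qed
qed

text \<open>
  The barycentric coordinates of \<open>X x\<close> are the \<open>x j\<close>, with the missing mass \<open>max 0 (1 - sum)\<close>
  spread evenly, divided by \<open>max 1 sum\<close>. This keeps the denominator away from 0 on the whole cube,
  so that Brouwer on the cube suffices and no simplex is needed.
\<close>

lemma cube_onto_simplex:
  fixes y :: "nat \<Rightarrow> 'a::real_normed_vector"
  assumes "n > 0"
  obtains X L where "L > 0"
    "\<And>x. \<forall>j<n. 0 \<le> x j \<Longrightarrow> X x \<in> convex hull (y ` {..<n})"
    "\<And>x. (\<Sum>j<n. x j) = 1 \<Longrightarrow> X x = (\<Sum>j<n. x j *\<^sub>R y j)"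
    "\<And>x x' d. \<forall>j<n. 0 \<le> x j \<Longrightarrow> \<forall>j<n. 0 \<le> x' j \<Longrightarrow> \<forall>j<n. \<bar>x j - x' j\<bar> \<le> d \<Longrightarrow> norm (X x - X x') \<le> L * d"
proof -
  define N where "N x j = x j + max 0 (1 - (\<Sum>i<n. x i)) / n" for x :: "nat \<Rightarrow> real" and j
  define D where "D x = max 1 (\<Sum>i<n. x i)" for x :: "nat \<Rightarrow> real"
  define X where "X x = (\<Sum>j<n. (N x j / D x) *\<^sub>R y j)" for x
  \<comment> \<open>The summand 1 keeps \<open>M\<close>, and with it the constant \<open>L\<close>,
    positive even if all \<open>y j\<close> vanish.\<close>
  define M where "M = 1 + (\<Sum>j<n. norm (y j))"
  have M: "norm (y j) \<le> M" if "j < n" for j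
    using member_le_sum[of j "{..<n}" "\<lambda>j. norm (y j)"] that by (auto simp: M_def)
  have "M > 0" unfolding M_def by (smt (verit) norm_ge_zero sum_nonneg)
  have D1: "D x \<ge> 1" for x by (simp add: D_def)
  have N0: "N x j \<ge> 0" if "\<forall>j<n. 0 \<le> x j" "j < n" for x j
    using that by (auto simp: N_def)
  have sumN: "(\<Sum>j<n. N x j) = D x" for x
    using assms by (auto simp: N_def D_def sum.distrib)
  have NleD: "N x j \<le> D x" if "\<forall>j<n. 0 \<le> x j" "j < n" for x j
    using member_le_sum[of j "{..<n}" "N x"] N0[OF that(1)] that by (auto simp: sumN)
  have lip: "norm (X x - X x') \<le> (real n * ((2 * n + 1) * M)) * d"
    if x: "\<forall>j<n. 0 \<le> x j" and x': "\<forall>j<n. 0 \<le> x' j" and d: "\<forall>j<n. \<bar>x j - x' j\<bar> \<le> d" for x x' d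
  proof -
    have s: "\<bar>(\<Sum>i<n. x i) - (\<Sum>i<n. x' i)\<bar> \<le> n * d"
    proof -
      have "\<bar>(\<Sum>i<n. x i) - (\<Sum>i<n. x' i)\<bar> \<le> (\<Sum>i<n. \<bar>x i - x' i\<bar>)"
        by (simp add: sum_subtractf[symmetric] sum_abs)
      also have "\<dots> \<le> n * d" using sum_bounded_above[of "{..<n}" "\<lambda>i. \<bar>x i - x' i\<bar>" d] d by auto
      finally show ?thesis .
    qed
    have Dd: "\<bar>D x - D x'\<bar> \<le> n * d" using s unfolding D_def by linarith
    have coef: "\<bar>N x j / D x - N x' j / D x'\<bar> \<le> (2 * n + 1) * d" if j: "j < n" for j
    proof -
      have "\<bar>max 0 (1 - (\<Sum>i<n. x i)) / n - max 0 (1 - (\<Sum>i<n. x' i)) / n\<bar>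
            = \<bar>max 0 (1 - (\<Sum>i<n. x i)) - max 0 (1 - (\<Sum>i<n. x' i))\<bar> / n"
        by (simp add: diff_divide_distrib[symmetric])
      also have "\<dots> \<le> \<bar>max 0 (1 - (\<Sum>i<n. x i)) - max 0 (1 - (\<Sum>i<n. x' i))\<bar> / 1"
        using assms by (intro divide_left_mono) auto
      also have "\<dots> \<le> n * d" using s by (simp only: div_by_1)
      finally have Nd: "\<bar>N x j - N x' j\<bar> \<le> d + n * d"
        using d j unfolding N_def by (smt (verit))
      \<comment> \<open>Numerator and denominator are changed one at a time. The first change costs
        \<open>d + n * d\<close>, the second \<open>n * d\<close>, because \<open>D\<close> is at
        least 1 and \<open>N x' j / D x'\<close> at most 1.\<close>
      have "N x j / D x - N x' j / D x' = (N x j - N x' j) / D x + (N x' j / D x') * ((D x' - D x) / D x)"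
        using D1[of x] D1[of x'] by (simp add: field_simps)
      also have "\<bar>\<dots>\<bar> \<le> \<bar>N x j - N x' j\<bar> / D x + (N x' j / D x') * (\<bar>D x' - D x\<bar> / D x)"
        using D1[of x] D1[of x'] N0[OF x' j]
        by (intro order_trans[OF abs_triangle_ineq]) (simp add: abs_mult)
      also have "\<dots> \<le> \<bar>N x j - N x' j\<bar> / 1 + 1 * (\<bar>D x' - D x\<bar> / 1)"
        using D1[of x] D1[of x'] N0[OF x' j] NleD[OF x' j]
        by (intro add_mono mult_mono divide_left_mono) (auto simp: divide_simps)
      also have "\<dots> \<le> d + n * d + n * d" using Nd Dd unfolding div_by_1 mult_1 by linarith
      finally show ?thesis by (simp add: algebra_simps)
    qed
    have "norm (X x - X x') = norm (\<Sum>j<n. (N x j / D x - N x' j / D x') *\<^sub>R y j)"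
      by (simp add: X_def sum_subtractf[symmetric] algebra_simps)
    also have "\<dots> \<le> (\<Sum>j<n. ((2 * n + 1) * d) * M)"
      by (rule sum_norm_le) (use coef M \<open>M > 0\<close> in \<open>force intro!: mult_mono\<close>)
    also have "\<dots> = (real n * ((2 * n + 1) * M)) * d" by simp
    finally show ?thesis .
  qed
  show thesis
  proof (rule that[of "real n * ((2 * n + 1) * M)" X])
    show "real n * ((2 * n + 1) * M) > 0" using assms \<open>M > 0\<close> by simp
    show "X x \<in> convex hull (y ` {..<n})" if "\<forall>j<n. 0 \<le> x j" for x
      unfolding X_def using N0[OF that] D1[of x] sumN[of x]
      by (intro convex_sum) (auto simp: sum_divide_distrib[symmetric] intro: hull_inc)
    show "X x = (\<Sum>j<n. x j *\<^sub>R y j)" if "(\<Sum>j<n. x j) = 1" for x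
      using that by (simp add: X_def N_def D_def)
  qed (rule lip)
qed

section \<open>Schauder's fixed point theorem\<close>

text \<open>The Schauder projection sends a point of \<open>K\<close> to an average of a finite
  \<open>e / 2\<close>-net, weighted by hat functions, and moves it by at most \<open>e / 2\<close>.
  Following \<open>T\<close> by this projection leaves a problem in finitely many coefficients,
  solved approximately on the cube at the cost of another \<open>e / 2\<close>.\<close>

lemma schauder_approx:
  fixes T :: "'a::real_normed_vector \<Rightarrow> 'a"
  assumes "convex S" "S \<noteq> {}" "continuous_on S T" "T ` S \<subseteq> K" "K \<subseteq> S" "compact K" "e > 0"
  shows "\<exists>x\<in>S. dist x (T x) \<le> e"
proof -
  obtain Y where Y: "Y \<subseteq> K" "finite Y" "K \<subseteq> (\<Union>y\<in>Y. ball y (e / 2))"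
  proof (rule compactE_image[OF \<open>compact K\<close>, of K "\<lambda>y. ball y (e/2)"])
    show "K \<subseteq> (\<Union>y\<in>K. ball y (e / 2))" using \<open>e > 0\<close> by fastforce
  qed (use \<open>e > 0\<close> in auto)
  have "Y \<noteq> {}" using Y assms by auto
  define n where "n = card Y"
  have "n > 0" using \<open>Y \<noteq> {}\<close> Y by (auto simp: n_def card_gt_0_iff)
  obtain y where y: "y ` {..<n} = Y"
    using ex_bij_betw_nat_finite[OF Y(2)] by (auto simp: n_def bij_betw_def lessThan_atLeast0)
  obtain X L where X: "L > 0"
    "\<And>x. \<forall>j<n. 0 \<le> x j \<Longrightarrow> X x \<in> convex hull Y"
    "\<And>x. (\<Sum>j<n. x j) = 1 \<Longrightarrow> X x = (\<Sum>j<n. x j *\<^sub>R y j)"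
    "\<And>x x' d. \<forall>j<n. 0 \<le> x j \<Longrightarrow> \<forall>j<n. 0 \<le> x' j \<Longrightarrow> \<forall>j<n. \<bar>x j - x' j\<bar> \<le> d \<Longrightarrow> norm (X x - X x') \<le> L * d"
    using cube_onto_simplex[OF \<open>n > 0\<close>, of y thesis] unfolding y by blast
  define C where "C = convex hull Y"
  have "compact C" unfolding C_def using Y by (simp add: finite_imp_compact_convex_hull)
  have "C \<subseteq> S" unfolding C_def using Y assms by (simp add: subset_hull)
  \<comment> \<open>\<open>m i\<close> is a hat function vanishing outside the ball of radius
    \<open>e / 2\<close> about \<open>y i\<close>. Since the balls cover \<open>K\<close>, the
    normalised \<open>\<mu> i\<close> form a partition of unity on \<open>K\<close>.\<close>
  define m where "m i z = max 0 (e / 2 - dist z (y i))" for i z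
  define \<mu> where "\<mu> i z = m i z / (\<Sum>j<n. m j z)" for i z
  have m0: "m i z \<ge> 0" for i z by (simp add: m_def)
  have mpos: "(\<Sum>j<n. m j z) > 0" if "z \<in> K" for z
  proof -
    have "z \<in> (\<Union>j<n. ball (y j) (e / 2))"
      using Y(3) that unfolding y[symmetric] by blast
    then obtain j where j: "j < n" "dist z (y j) < e / 2"
      by (force simp: dist_commute)
    then have "m j z > 0" by (simp add: m_def)
    then show ?thesis using j(1) m0 by (simp add: sum_pos2)
  qed
  have \<mu>01: "\<mu> i z \<in> {0..1}" if "z \<in> K" "i < n" for z i
    using mpos[OF that(1)] m0 that(2) member_le_sum[of i "{..<n}" "\<lambda>j. m j z"]
    by (auto simp: \<mu>_def divide_simps)
  have \<mu>sum: "(\<Sum>i<n. \<mu> i z) = 1" if "z \<in> K" for z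
    using mpos[OF that] by (simp add: \<mu>_def sum_divide_distrib[symmetric])
  have "continuous_on C T" using assms(3) \<open>C \<subseteq> S\<close> continuous_on_subset by blast
  have TC: "T z \<in> K" if "z \<in> C" for z using that \<open>C \<subseteq> S\<close> assms by blast
  \<comment> \<open>An error of \<open>e1\<close> in every coefficient becomes at most
    \<open>L * e1 = e / 2\<close> after applying \<open>X\<close>.\<close>
  define e1 where "e1 = e / (2 * L)"
  have "e1 > 0" using \<open>e > 0\<close> X(1) by (simp add: e1_def)
  have "\<exists>d>0. \<forall>z\<in>C. \<forall>z'\<in>C. dist z' z < d \<longrightarrow> dist (\<mu> i (T z')) (\<mu> i (T z)) < e1 / 2" for i
  proof -
    have "continuous_on C (\<lambda>z. \<mu> i (T z))"
      unfolding \<mu>_def m_def using TC mpos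
      by (intro continuous_intros \<open>continuous_on C T\<close>) (force simp: m_def)
    then have "uniformly_continuous_on C (\<lambda>z. \<mu> i (T z))"
      using \<open>compact C\<close> compact_uniformly_continuous by blast
    then show ?thesis using \<open>e1 > 0\<close> unfolding uniformly_continuous_on_def by (meson half_gt_zero)
  qed
  then obtain df where df: "\<And>i. df i > 0"
    "\<And>i z z'. z \<in> C \<Longrightarrow> z' \<in> C \<Longrightarrow> dist z' z < df i \<Longrightarrow> dist (\<mu> i (T z')) (\<mu> i (T z)) < e1 / 2"
    by metis
  define d0 where "d0 = Min (df ` {..<n})"
  have "d0 > 0" unfolding d0_def using df \<open>n > 0\<close> by (subst Min_gr_iff) auto
  have d0le: "d0 \<le> df i" if "i < n" for i unfolding d0_def using that by auto
  \<comment> \<open>The first entry keeps the total error \<open>e1 / 2 + d\<close> below or at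
    \<open>e1\<close>; the second gives \<open>L * d < d0\<close>, so that the uniform continuity of
    the weights applies.\<close>
  define d where "d = min (e1 / 2) (d0 / (2 * L))"
  have "d > 0" using \<open>e1 > 0\<close> \<open>d0 > 0\<close> X(1) by (simp add: d_def)
  have "L * d \<le> L * (d0 / (2 * L))" using X(1) by (intro mult_left_mono) (auto simp: d_def)
  also have "\<dots> < d0" using X(1) \<open>d0 > 0\<close> by simp
  finally have Ld: "L * d < d0" .
  \<comment> \<open>The unknown is a vector of coefficients: form the point \<open>X x\<close>,
    apply \<open>T\<close>, and read off the weights of the image.\<close>
  define F where "F x i = \<mu> i (T (X x))" for x i
  obtain x where x: "\<forall>j<n. x j \<in> {0..1}" "\<forall>i<n. \<bar>F x i - x i\<bar> \<le> e1 / 2 + d"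
  proof (rule approx_fixed_point_cube[of n F d "e1 / 2"])
    show "F x i \<in> {0..1}" if "\<forall>j<n. x j \<in> {0..1}" "i < n" for x i
      unfolding F_def using that X(2)[of x] TC by (intro \<mu>01) (auto simp: C_def)
    show "\<bar>F x i - F x' i\<bar> \<le> e1 / 2"
      if "\<forall>j<n. x j \<in> {0..1}" "\<forall>j<n. x' j \<in> {0..1}" "\<forall>j<n. \<bar>x j - x' j\<bar> \<le> d" "i < n" for x x' i
    proof -
      have "dist (X x) (X x') \<le> L * d" unfolding dist_norm using that X(4)[of x x' d] by auto
      then have "dist (X x) (X x') < df i" using Ld d0le[OF that(4)] by linarith
      then have "dist (F x i) (F x' i) < e1 / 2" unfolding F_def
        using that X(2)[of x] X(2)[of x'] by (intro df(2)) (auto simp: C_def)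
      then show ?thesis by (simp add: dist_real_def)
    qed
  qed (use \<open>d > 0\<close> in auto)
  define z where "z = X x"
  have "z \<in> C" unfolding z_def C_def using x(1) by (intro X(2)) auto
  \<comment> \<open>The weights add up to 1, so \<open>X\<close> returns their plain combination:
    \<open>X (F x)\<close> is the Schauder projection of \<open>T z\<close>.\<close>
  have XF: "X (F x) = (\<Sum>i<n. \<mu> i (T z) *\<^sub>R y i)"
    using X(3)[of "F x"] \<mu>sum[OF TC[OF \<open>z \<in> C\<close>]] by (simp add: F_def z_def)
  have "norm (X x - X (F x)) \<le> L * e1"
  proof (rule X(4))
    show "\<forall>j<n. 0 \<le> F x j" unfolding F_def z_def[symmetric] using \<mu>01[OF TC[OF \<open>z \<in> C\<close>]] by auto
    show "\<forall>j<n. \<bar>x j - F x j\<bar> \<le> e1" using x(2) unfolding d_def by (smt (verit) field_sum_of_halves)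
  qed (use x in auto)
  then have 1: "norm (z - X (F x)) \<le> e / 2" using X(1) by (simp add: e1_def z_def)
  have "X (F x) - T z = (\<Sum>i<n. \<mu> i (T z) *\<^sub>R (y i - T z))"
    unfolding XF using \<mu>sum[OF TC[OF \<open>z \<in> C\<close>]]
    by (simp add: scaleR_diff_right sum_subtractf flip: scaleR_left.sum)
  also have "norm \<dots> \<le> (\<Sum>i<n. \<mu> i (T z) * (e / 2))"
  proof (rule sum_norm_le)
    fix i assume i: "i \<in> {..<n}"
    have "\<mu> i (T z) * norm (y i - T z) \<le> \<mu> i (T z) * (e / 2)"
    proof (cases "norm (y i - T z) \<le> e / 2")
      case True
      then show ?thesis using \<mu>01[OF TC[OF \<open>z \<in> C\<close>]] i by (intro mult_left_mono) auto
    next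
      case False
      then have "\<mu> i (T z) = 0" by (simp add: \<mu>_def m_def dist_norm norm_minus_commute)
      then show ?thesis by simp
    qed
    then show "norm (\<mu> i (T z) *\<^sub>R (y i - T z)) \<le> \<mu> i (T z) * (e / 2)"
      using \<mu>01[OF TC[OF \<open>z \<in> C\<close>]] i by auto
  qed
  also have "\<dots> = (\<Sum>i<n. \<mu> i (T z)) * (e / 2)" by (rule sum_distrib_right[symmetric])
  also have "\<dots> = e / 2" using \<mu>sum[OF TC[OF \<open>z \<in> C\<close>]] by simp
  finally have 2: "norm (X (F x) - T z) \<le> e / 2" .
  have "norm (z - T z) \<le> e" using norm_triangle_ineq[of "z - X (F x)" "X (F x) - T z"] 1 2 by simp
  then show ?thesis using \<open>z \<in> C\<close> \<open>C \<subseteq> S\<close> by (auto simp: dist_norm)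
qed

text \<open>Take approximate fixed points \<open>x n\<close> with tolerances tending to 0. By
  compactness of \<open>K\<close> a subsequence of \<open>T (x n)\<close> converges, the
  corresponding \<open>x n\<close> have the same limit, and continuity of \<open>T\<close> there
  finishes the argument.\<close>

theorem schauder_fixed_point:
  fixes T :: "'a::real_normed_vector \<Rightarrow> 'a"
  assumes "convex S" "S \<noteq> {}" "continuous_on S T" "T ` S \<subseteq> K" "K \<subseteq> S" "compact K"
  obtains x where "x \<in> K" "T x = x"
proof -
  have "\<exists>x\<in>S. dist x (T x) \<le> inverse (Suc n)" for n
    by (rule schauder_approx[OF assms]) simp
  then obtain x where x: "\<And>n. x n \<in> S" "\<And>n. dist (x n) (T (x n)) \<le> inverse (Suc n)"
    by metis
  have "\<forall>n. T (x n) \<in> K" using x assms by auto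
  then obtain l k where l: "l \<in> K" "strict_mono (k :: nat \<Rightarrow> nat)" "((\<lambda>n. T (x n)) \<circ> k) \<longlonglongrightarrow> l"
    using \<open>compact K\<close> unfolding compact_def by metis
  have "(\<lambda>n. dist (x (k n)) (T (x (k n)))) \<longlonglongrightarrow> 0"
  proof (rule tendsto_sandwich[OF _ _ tendsto_const])
    show "(\<lambda>n. inverse (real (Suc (k n)))) \<longlonglongrightarrow> 0"
      using LIMSEQ_subseq_LIMSEQ[OF LIMSEQ_inverse_real_of_nat l(2)] by (simp add: o_def)
  qed (use x in auto)
  then have "(\<lambda>n. x (k n)) \<longlonglongrightarrow> l"
    using l(3) Lim_transform by (force simp: o_def dist_norm tendsto_norm_zero_iff)
  then have "(\<lambda>n. T (x (k n))) \<longlonglongrightarrow> T l"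
    using assms(3,5) l(1) x(1) by (intro continuous_on_tendsto_compose[OF assms(3)]) auto
  moreover have "(\<lambda>n. T (x (k n))) \<longlonglongrightarrow> l" using l(3) by (simp add: o_def)
  ultimately have "T l = l" by (rule LIMSEQ_unique)
  then show thesis using that l by blast
qed

section \<open>The Birkhoff-Kellogg theorem in a cone\<close>

text \<open>The lower bound \<open>\<delta>\<close> keeps the normalisation of \<open>F\<close> away
  from its singularity at 0, so that compactness of \<open>Q\<close> carries over to the normalised
  values. The factor \<open>s\<close> comes out as \<open>\<rho> / norm (F x)\<close>.\<close>

theorem birkhoff_kellogg_cone:
  fixes F :: "'a::real_normed_vector \<Rightarrow> 'a"
  assumes "convex K" and cone: "\<And>x s. x \<in> K \<Longrightarrow> s \<ge> 0 \<Longrightarrow> s *\<^sub>R x \<in> K"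
    and e: "e \<in> K" "- e \<notin> K"
    and "\<rho> > 0" and cont: "continuous_on {x \<in> K. norm x = \<rho>} F"
    and FQ: "\<And>x. x \<in> K \<Longrightarrow> norm x = \<rho> \<Longrightarrow> F x \<in> Q" and Q: "Q \<subseteq> K" "compact Q"
    and "\<delta> > 0" and F\<delta>: "\<And>x. x \<in> K \<Longrightarrow> norm x = \<rho> \<Longrightarrow> norm (F x) \<ge> \<delta>"
  obtains x s where "x \<in> K" "norm x = \<rho>" "s > 0" "x = s *\<^sub>R F x"
proof -
  \<comment> \<open>\<open>N \<circ> P\<close> retracts the cone onto its sphere: since \<open>e\<close> is not invertible in the cone, \<open>P\<close> avoids 0.\<close>
  define N where "N x = (\<rho> / norm x) *\<^sub>R x" for x :: 'a
  define P where "P x = x + max 0 (\<rho> - norm x) *\<^sub>R e" for x :: 'a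
  have NK: "N x \<in> K" if "x \<in> K" for x using that cone \<open>\<rho> > 0\<close> by (simp add: N_def)
  have Nn: "norm (N x) = \<rho>" if "x \<noteq> 0" for x using that \<open>\<rho> > 0\<close> by (simp add: N_def)
  have Ncont: "continuous_on (- {0}) N" unfolding N_def by (intro continuous_intros) auto
  have add: "x + y \<in> K" if "x \<in> K" "y \<in> K" for x y
  proof -
    have "2 *\<^sub>R ((1/2) *\<^sub>R x + (1/2) *\<^sub>R y) \<in> K"
      by (intro cone convexD[OF \<open>convex K\<close>] that) auto
    then show ?thesis by (simp add: scaleR_add_right)
  qed
  have PK: "P x \<in> K" if "x \<in> K" for x unfolding P_def using that e cone by (intro add) auto
  have P0: "P x \<noteq> 0" if "x \<in> K" for x
  proof
    define s where "s = max 0 (\<rho> - norm x)"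
    assume "P x = 0"
    then have *: "x = - (s *\<^sub>R e)" by (simp add: P_def s_def eq_neg_iff_add_eq_0)
    show False
    proof (cases "s = 0")
      case True
      then have "x = 0" using * by simp
      with True show False using \<open>\<rho> > 0\<close> by (simp add: s_def)
    next
      case False
      then have "(1 / s) *\<^sub>R x = - e" using * by simp
      moreover have "(1 / s) *\<^sub>R x \<in> K" using that by (intro cone) (auto simp: s_def)
      ultimately show False using e by simp
    qed
  qed
  define R where "R x = N (P x)" for x
  have R: "R x \<in> {x \<in> K. norm x = \<rho>}" if "x \<in> K" for x
    using NK PK Nn P0 that by (simp add: R_def)
  have Rcont: "continuous_on K R"
    unfolding R_def
    by (rule continuous_on_compose2[OF Ncont]) (auto simp: P_def[abs_def] P0[unfolded P_def] intro!: continuous_intros)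
  \<comment> \<open>\<open>N\<close> is continuous away from 0, so the open ball that
    \<open>F\<close> misses is cut out of \<open>Q\<close>. What remains is compact and avoids 0,
    hence has a compact image under \<open>N\<close>.\<close>
  define Q' where "Q' = Q \<inter> - ball 0 \<delta>"
  have "compact Q'" unfolding Q'_def using Q by (simp add: compact_Int_closed closed_Compl)
  have Q'0: "Q' \<subseteq> - {0}" using \<open>\<delta> > 0\<close> by (auto simp: Q'_def)
  have FQ': "F (R x) \<in> Q'" if "x \<in> K" for x using R[OF that] FQ F\<delta> by (auto simp: Q'_def not_less)
  obtain x where x: "x \<in> N ` Q'" "N (F (R x)) = x"
  proof (rule schauder_fixed_point[of K "\<lambda>x. N (F (R x))" "N ` Q'"])
    show "continuous_on K (\<lambda>x. N (F (R x)))"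
    proof (rule continuous_on_compose2[OF Ncont])
      show "continuous_on K (\<lambda>x. F (R x))"
        using R by (intro continuous_on_compose2[OF cont Rcont]) auto
    qed (use FQ' Q'0 in fast)
    show "compact (N ` Q')"
      using Ncont Q'0 \<open>compact Q'\<close> by (meson compact_continuous_image continuous_on_subset)
  qed (use assms FQ' NK in \<open>auto simp: Q'_def\<close>)
  then obtain w where "w \<in> Q'" "x = N w" by blast
  moreover have "w \<in> K" "w \<noteq> 0" using \<open>w \<in> Q'\<close> Q Q'0 by (auto simp: Q'_def)
  ultimately have "x \<in> K" "norm x = \<rho>" using NK Nn by auto
  \<comment> \<open>On the sphere the push along \<open>e\<close> has coefficient 0, and rescaling
    to norm \<open>\<rho>\<close> is the identity.\<close>
  then have "R x = x" using \<open>\<rho> > 0\<close> by (simp add: R_def P_def N_def)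
  then have "x = (\<rho> / norm (F x)) *\<^sub>R F x" using x(2) by (simp add: N_def)
  moreover have "\<rho> / norm (F x) > 0"
    using F\<delta>[OF \<open>x \<in> K\<close> \<open>norm x = \<rho>\<close>] \<open>\<delta> > 0\<close> \<open>\<rho> > 0\<close> by (intro divide_pos_pos) auto
  ultimately show thesis using that \<open>x \<in> K\<close> \<open>norm x = \<rho>\<close> by blast
qed

section \<open>Compactness in the space of bounded continuous functions\<close>

lemma continuous_on_eval_bcontfun:
  "continuous_on S (\<lambda>g :: 'a::topological_space \<Rightarrow>\<^sub>C 'b::metric_space. apply_bcontfun g t)"
  unfolding continuous_on_def
  by (auto intro!: tendsto_uniform_limitI[OF tendsto_bcontfun_uniform_limit] tendsto_ident_at)

text \<open>Arzela-Ascoli works on a compact domain. By \<open>clamp\<close> the members of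
  \<open>Q\<close> are determined by their values on \<open>{0..1}\<close>, so uniform convergence
  there is uniform convergence on the line, and closedness of \<open>Q\<close> catches the
  limit.\<close>

lemma compact_equilipschitz:
  fixes Q :: "(real \<Rightarrow>\<^sub>C real) set"
  assumes "closed Q"
    and bound: "\<And>g. g \<in> Q \<Longrightarrow> norm g \<le> P"
    and lip: "\<And>g s t. g \<in> Q \<Longrightarrow> \<bar>g s - g t\<bar> \<le> \<Lambda> * \<bar>s - t\<bar>"
    and clamp: "\<And>g t. g \<in> Q \<Longrightarrow> g t = g (max 0 (min 1 t))"
  shows "compact Q"
  unfolding compact_def
proof (intro allI impI)
  fix g :: "nat \<Rightarrow> real \<Rightarrow>\<^sub>C real"
  assume gQ: "\<forall>n. g n \<in> Q"
  obtain h k where h: "continuous_on {0..1} h" and k: "strict_mono (k :: nat \<Rightarrow> nat)"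
    and lim: "\<And>e. 0 < e \<Longrightarrow> \<exists>N. \<forall>n x. n \<ge> N \<and> x \<in> {0..1} \<longrightarrow> norm (g (k n) x - h x) < e"
  proof (rule Arzela_Ascoli[of "{0..1::real}" "\<lambda>n. apply_bcontfun (g n)" P])
    show "norm (g n x) \<le> P" for n x
      using norm_bounded[of "g n" x] bound[of "g n"] gQ by force
    show "\<exists>d>0. \<forall>n y. y \<in> {0..1} \<and> norm (x - y) < d \<longrightarrow> norm (g n x - g n y) < e"
      if "e > 0" for x e :: real
    \<comment> \<open>The denominator is positive whatever the value of \<open>\<Lambda>\<close>,
      including 0.\<close>
    proof (intro exI[of _ "e / (\<bar>\<Lambda>\<bar> + 1)"] conjI allI impI)
      show "e / (\<bar>\<Lambda>\<bar> + 1) > 0" using that by simp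
      fix n y assume "y \<in> {0..1} \<and> norm (x - y) < e / (\<bar>\<Lambda>\<bar> + 1)"
      then have "(\<bar>\<Lambda>\<bar> + 1) * \<bar>x - y\<bar> < e" by (simp add: field_simps)
      moreover have "\<Lambda> * \<bar>x - y\<bar> \<le> (\<bar>\<Lambda>\<bar> + 1) * \<bar>x - y\<bar>" by (intro mult_right_mono) auto
      ultimately show "norm (g n x - g n y) < e" using lip[of "g n" x y] gQ by force
    qed
  qed auto
  define h' where "h' t = h (max 0 (min 1 t))" for t
  have "uniform_limit UNIV (\<lambda>n. apply_bcontfun (g (k n))) h' sequentially"
  proof (rule uniform_limitI)
    fix e :: real assume "e > 0"
    then obtain N where N: "\<forall>n x. n \<ge> N \<and> x \<in> {0..1} \<longrightarrow> norm (g (k n) x - h x) < e"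
      using lim by blast
    have "dist (g (k n) x) (h' x) < e" if "n \<ge> N" for n x
      using N[rule_format, of n "max 0 (min 1 x)"] that gQ clamp[of "g (k n)" x]
      by (simp add: h'_def dist_norm)
    then show "\<forall>\<^sub>F n in sequentially. \<forall>x\<in>UNIV. dist (g (k n) x) (h' x) < e"
      using eventually_sequentially by auto
  qed
  then obtain l where l: "(\<lambda>n. g (k n)) \<longlonglongrightarrow> l"
    by (rule uniform_limit_bcontfunE) auto
  then have "l \<in> Q"
    using closed_sequentially[OF \<open>closed Q\<close>, of "\<lambda>n. g (k n)"] gQ by auto
  then show "\<exists>l\<in>Q. \<exists>r. strict_mono r \<and> (g \<circ> r) \<longlonglongrightarrow> l"
    using k l by (auto simp: o_def)
qed

section \<open>The Green kernel and the cone\<close>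

locale bvp_kernel =
  fixes \<beta> \<eta> a b c :: real
  assumes \<beta>: "\<beta> > 0" and \<eta>: "\<eta> > 0" and \<kappa>1: "\<beta> + \<eta> < 1"
    and a: "a > 0" and ab: "a \<le> b" and b: "b < \<beta> + \<eta>"
    and c: "c = c1 \<beta> \<eta> a b"
begin

text \<open>
  \<open>s \<mapsto> M * s\<close> is the majorant \<open>\<Phi>\<close> of the kernel, with \<open>k(t,s) \<ge> c * \<Phi>(s)\<close> for \<open>t \<in> [a,b]\<close>; the two cases in the
  definition of \<^const>\<open>c1\<close> are the two values of this maximum.
\<close>

definition "M = max 1 ((1 - (\<beta> + \<eta>)) / (\<beta> + \<eta>))"

lemma M1: "M \<ge> 1" by (simp add: M_def)

text \<open>The denominator in either case of \<open>c1\<close> is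
  \<open>(\<beta> + \<eta>) * M\<close>, so the case distinction disappears from the
  product.\<close>

lemma c_times_M: "c * M = min (a * \<beta> / (\<beta> + \<eta>)) ((\<beta> + \<eta> - b) / (\<beta> + \<eta>))"
proof (cases "\<beta> + \<eta> \<ge> 1 / 2")
  case True
  then have "M = 1" using \<beta> \<eta> by (simp add: M_def field_simps)
  then show ?thesis using True by (simp add: c c1_def)
next
  case False
  then have M: "M = (1 - (\<beta> + \<eta>)) / (\<beta> + \<eta>)" using \<beta> \<eta> by (simp add: M_def field_simps)
  have "M > 0" using M1 by simp
  then have "c * M = min (a * \<beta> / (1 - (\<beta> + \<eta>)) * M) ((\<beta> + \<eta> - b) / (1 - (\<beta> + \<eta>)) * M)"
    using False by (simp add: c c1_def min_mult_distrib_right)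
  then show ?thesis using \<kappa>1 \<beta> \<eta> by (simp add: M)
qed

lemma c_pos: "c > 0"
proof -
  have "c * M > 0" unfolding c_times_M using a \<beta> \<eta> b by simp
  then show ?thesis using M1 by (simp add: zero_less_mult_iff)
qed

text \<open>The boundary term calls for this: on \<open>{a..b}\<close> the function
  \<open>gamma_fn\<close> is \<open>t / (\<beta> + \<eta>)\<close> with \<open>t \<ge> a\<close>. It
  follows from \<open>M \<ge> 1\<close> and \<open>\<beta> \<le> \<beta> + \<eta>\<close>.\<close>

lemma c_le_a: "c \<le> a"
proof -
  have "c \<le> c * M" using c_pos M1 by simp
  also have "\<dots> \<le> a * \<beta> / (\<beta> + \<eta>)" by (simp add: c_times_M)
  also have "\<dots> \<le> a" using a \<beta> \<eta> by (simp add: field_simps)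
  finally show ?thesis .
qed

section \<open>Pointwise estimates of the Green kernel\<close>

text \<open>Each product \<open>x * heaviside x\<close> is a positive part. For
  \<open>s \<ge> 0\<close> the outer factor \<open>heaviside t\<close> changes nothing in the last
  term, because \<open>t \<ge> s\<close> already gives \<open>t \<ge> 0\<close>.\<close>

lemma green_kernel_eq:
  assumes "s \<ge> 0"
  shows "green_kernel \<beta> \<eta> t s = max 0 t * ((\<beta> + max 0 (\<eta> - s)) / (\<beta> + \<eta>)) - max 0 (t - s)"
  using assms
  by (auto simp: green_kernel_def heaviside_def max_def add_divide_distrib diff_divide_distrib algebra_simps)

lemma green_kernel_mult_eq:
  assumes "s \<ge> 0" "t \<ge> 0"
  shows "green_kernel \<beta> \<eta> t s * (\<beta> + \<eta>) = t * (\<beta> + max 0 (\<eta> - s)) - max 0 (t - s) * (\<beta> + \<eta>)"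
proof -
  have "\<beta> + \<eta> \<noteq> 0" using \<beta> \<eta> by simp
  then show ?thesis using assms by (simp add: green_kernel_eq left_diff_distrib)
qed

lemma gamma_fn_eq: "gamma_fn \<beta> \<eta> t = max 0 t / (\<beta> + \<eta>)"
  by (auto simp: gamma_fn_def heaviside_def max_def)

text \<open>For fixed \<open>s\<close> the kernel is a difference of two positive parts in
  \<open>t\<close>, with factors \<open>q\<close> between 0 and 1 and 1 respectively; each
  contributes at most 1 to the constant.\<close>

lemma green_kernel_Lipschitz:
  assumes "s \<ge> 0"
  shows "\<bar>green_kernel \<beta> \<eta> t s - green_kernel \<beta> \<eta> t' s\<bar> \<le> 2 * \<bar>t - t'\<bar>"
proof -
  define q where "q = (\<beta> + max 0 (\<eta> - s)) / (\<beta> + \<eta>)"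
  have q: "0 \<le> q" "q \<le> 1" using assms \<beta> \<eta> by (auto simp: q_def field_simps)
  have "green_kernel \<beta> \<eta> t s - green_kernel \<beta> \<eta> t' s = (max 0 t - max 0 t') * q - (max 0 (t - s) - max 0 (t' - s))"
    unfolding green_kernel_eq[OF assms] q_def[symmetric] by (simp add: algebra_simps)
  also have "\<bar>\<dots>\<bar> \<le> \<bar>max 0 t - max 0 t'\<bar> * q + \<bar>max 0 (t - s) - max 0 (t' - s)\<bar>"
    using q by (intro order_trans[OF abs_triangle_ineq4]) (simp add: abs_mult)
  also have "\<dots> \<le> \<bar>t - t'\<bar> * 1 + \<bar>t - t'\<bar>"
    using q by (intro add_mono mult_mono) auto
  finally show ?thesis by simp
qed

text \<open>Multiplied by \<open>\<kappa>\<close>, the kernel is a polynomial on each of the four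
  regions cut out by \<open>s = t\<close> and \<open>s = \<eta>\<close>. It never exceeds
  \<open>s * \<kappa>\<close>; for \<open>s < t\<close> it may be negative but stays above
  \<open>- (1 - \<kappa>) * s\<close>, which accounts for the second entry of
  \<open>M\<close>.\<close>

lemma green_kernel_bound:
  assumes "0 \<le> s" "s \<le> 1" "t \<le> 1"
  shows "\<bar>green_kernel \<beta> \<eta> t s\<bar> \<le> M * s"
proof -
  define \<kappa> where "\<kappa> = \<beta> + \<eta>"
  have \<kappa>: "\<kappa> > 0" "\<kappa> < 1" "\<eta> < \<kappa>" using \<beta> \<eta> \<kappa>1 by (auto simp: \<kappa>_def)
  have M: "s * \<kappa> \<le> M * s * \<kappa>" "(1 - \<kappa>) * s \<le> M * s * \<kappa>"
  proof -
    have "1 * \<kappa> \<le> M * \<kappa>" using M1 \<kappa> by (intro mult_right_mono) auto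
    then show "s * \<kappa> \<le> M * s * \<kappa>" using mult_left_mono[OF _ assms(1), of "1 * \<kappa>" "M * \<kappa>"]
      by (simp add: algebra_simps)
    have "((1 - \<kappa>) / \<kappa>) * \<kappa> \<le> M * \<kappa>" using \<kappa> by (intro mult_right_mono) (auto simp: M_def \<kappa>_def)
    then have "1 - \<kappa> \<le> M * \<kappa>" using \<kappa> by simp
    then show "(1 - \<kappa>) * s \<le> M * s * \<kappa>" using mult_right_mono[OF _ assms(1), of "1 - \<kappa>" "M * \<kappa>"]
      by (simp add: algebra_simps)
  qed
  have "\<bar>green_kernel \<beta> \<eta> t s * \<kappa>\<bar> \<le> M * s * \<kappa>"
  proof (cases "t \<le> 0")
    case True
    then have "green_kernel \<beta> \<eta> t s = 0" using assms by (simp add: green_kernel_eq max_absorb1)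
    then show ?thesis using M1 \<kappa> assms by simp
  next
    case t: False
    consider "t \<le> s" "s \<le> \<eta>" | "t \<le> s" "s > \<eta>" | "t > s" "s \<le> \<eta>" | "t > s" "s > \<eta>" by linarith
    then show ?thesis
    proof cases
      case 1
      have "green_kernel \<beta> \<eta> t s * \<kappa> = t * (\<kappa> - s)"
        using 1 t assms green_kernel_mult_eq[of s t] unfolding \<kappa>_def
          by (simp add: max_absorb1 max_absorb2 algebra_simps)
      moreover have "0 \<le> t * (\<kappa> - s)" "t * (\<kappa> - s) \<le> s * \<kappa>"
        using 1 t \<kappa> assms by (auto intro!: mult_mono)
      ultimately show ?thesis using M by linarith
    next
      case 2
      have "green_kernel \<beta> \<eta> t s * \<kappa> = t * \<beta>"
        using 2 t assms green_kernel_mult_eq[of s t] unfolding \<kappa>_def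
          by (simp add: max_absorb1 max_absorb2 algebra_simps)
      moreover have "0 \<le> t * \<beta>" "t * \<beta> \<le> s * \<kappa>"
        using 2 t \<beta> \<eta> assms by (auto intro!: mult_mono simp: \<kappa>_def)
      ultimately show ?thesis using M by linarith
    next
      case 3
      have "green_kernel \<beta> \<eta> t s * \<kappa> = s * (\<kappa> - t)"
        using 3 t assms green_kernel_mult_eq[of s t] unfolding \<kappa>_def
          by (simp add: max_absorb1 max_absorb2 algebra_simps)
      moreover have "s * (\<kappa> - t) \<le> s * \<kappa>" "s * (t - \<kappa>) \<le> s * (1 - \<kappa>)"
        using 3 t \<kappa> assms by (auto intro!: mult_left_mono)
      ultimately show ?thesis using M by (simp add: abs_le_iff algebra_simps)
    next
      case 4
      have "green_kernel \<beta> \<eta> t s * \<kappa> = s * \<kappa> - t * \<eta>"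
        using 4 t assms green_kernel_mult_eq[of s t] unfolding \<kappa>_def
          by (simp add: max_absorb1 max_absorb2 algebra_simps)
      moreover have "0 \<le> t * \<eta>" "t * \<eta> \<le> 1 * s"
        using 4 t \<eta> assms mult_mono[of t 1 \<eta> s] by auto
      ultimately show ?thesis using M by (simp add: abs_le_iff algebra_simps)
    qed
  qed
  then have "\<bar>green_kernel \<beta> \<eta> t s\<bar> * \<kappa> \<le> (M * s) * \<kappa>" using \<kappa> by (simp add: abs_mult)
  then show ?thesis using \<kappa> by simp
qed

text \<open>On the same four regions the two entries of \<open>c * M\<close> serve in turn: times
  \<open>\<kappa>\<close>, the kernel is at least \<open>a * \<beta>\<close> for
  \<open>t \<le> s\<close>, which suffices as \<open>s \<le> 1\<close>, and at least
  \<open>(\<kappa> - b) * s\<close> for \<open>s < t\<close>.\<close>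

lemma green_kernel_lower:
  assumes "0 \<le> s" "s \<le> 1" "t \<in> {a..b}"
  shows "c * (M * s) \<le> green_kernel \<beta> \<eta> t s"
proof -
  define \<kappa> where "\<kappa> = \<beta> + \<eta>"
  have \<kappa>: "\<kappa> > 0" "\<kappa> < 1" "\<eta> < \<kappa>" "b < \<kappa>" using \<beta> \<eta> \<kappa>1 b by (auto simp: \<kappa>_def)
  have t: "t > 0" "a \<le> t" "t \<le> b" using assms a by auto
  have "c * M * \<kappa> = min (a * \<beta> / \<kappa> * \<kappa>) ((\<kappa> - b) / \<kappa> * \<kappa>)"
    unfolding c_times_M \<kappa>_def[symmetric] using \<kappa>(1) by (simp add: min_mult_distrib_right)
  then have *: "c * M * \<kappa> \<le> a * \<beta>" "c * M * \<kappa> \<le> \<kappa> - b" using \<kappa> by auto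
  have "a * \<beta> * s \<le> a * \<beta> * 1" using a \<beta> assms by (intro mult_left_mono) auto
  moreover have "c * M * \<kappa> * s \<le> a * \<beta> * s" "c * M * \<kappa> * s \<le> (\<kappa> - b) * s"
    using * assms by (auto intro!: mult_right_mono)
  ultimately have C: "c * M * \<kappa> * s \<le> a * \<beta>" "c * M * \<kappa> * s \<le> (\<kappa> - b) * s" by linarith+
  have "c * M * \<kappa> * s \<le> green_kernel \<beta> \<eta> t s * \<kappa>"
  proof -
    consider "t \<le> s" "s \<le> \<eta>" | "t \<le> s" "s > \<eta>" | "t > s" "s \<le> \<eta>" | "t > s" "s > \<eta>" by linarith
    then show ?thesis
    proof cases
      case 1
      have "green_kernel \<beta> \<eta> t s * \<kappa> = t * (\<kappa> - s)"
        using 1 t assms green_kernel_mult_eq[of s t] unfolding \<kappa>_def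
          by (simp add: max_absorb1 max_absorb2 algebra_simps)
      moreover have "a * \<beta> \<le> t * (\<kappa> - s)"
        using 1 t \<kappa> a \<beta> assms by (intro mult_mono) (auto simp: \<kappa>_def)
      ultimately show ?thesis using C by linarith
    next
      case 2
      have "green_kernel \<beta> \<eta> t s * \<kappa> = t * \<beta>"
        using 2 t assms green_kernel_mult_eq[of s t] unfolding \<kappa>_def
          by (simp add: max_absorb1 max_absorb2 algebra_simps)
      moreover have "a * \<beta> \<le> t * \<beta>" using t \<beta> by (intro mult_right_mono) auto
      ultimately show ?thesis using C by linarith
    next
      case 3
      have "green_kernel \<beta> \<eta> t s * \<kappa> = (\<kappa> - t) * s"
        using 3 t assms green_kernel_mult_eq[of s t] unfolding \<kappa>_def
          by (simp add: max_absorb1 max_absorb2 algebra_simps)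
      moreover have "(\<kappa> - b) * s \<le> (\<kappa> - t) * s"
        using t assms by (intro mult_right_mono) auto
      ultimately show ?thesis using C by linarith
    next
      case 4
      have "green_kernel \<beta> \<eta> t s * \<kappa> = s * \<kappa> - t * \<eta>"
        using 4 t assms green_kernel_mult_eq[of s t] unfolding \<kappa>_def
          by (simp add: max_absorb1 max_absorb2 algebra_simps)
      moreover have "t * \<eta> \<le> b * s" using 4 t \<eta> assms by (intro mult_mono) auto
      ultimately show ?thesis using C by (simp add: algebra_simps)
    qed
  qed
  then have "(c * (M * s)) * \<kappa> \<le> green_kernel \<beta> \<eta> t s * \<kappa>" by (simp add: algebra_simps)
  then show ?thesis using \<kappa> by simp
qed

lemma green_kernel_nonneg:
  assumes "0 \<le> s" "s \<le> 1" "t \<in> {a..b}"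
  shows "green_kernel \<beta> \<eta> t s \<ge> 0"
proof -
  have "0 \<le> c * (M * s)" using c_pos M1 assms by simp
  then show ?thesis using green_kernel_lower[OF assms] by linarith
qed

section \<open>The Hammerstein integral operator\<close>

lemma continuous_green_kernel:
  assumes "S \<subseteq> {0..1}"
  shows "continuous_on S (green_kernel \<beta> \<eta> t)"
proof -
  have "continuous_on S (\<lambda>s. max 0 t * ((\<beta> + max 0 (\<eta> - s)) / (\<beta> + \<eta>)) - max 0 (t - s))"
    using \<beta> \<eta> by (intro continuous_intros) auto
  then show ?thesis
    by (rule continuous_on_eq) (use assms in \<open>auto simp: green_kernel_eq\<close>)
qed

lemma integrable_green:
  assumes "continuous_on {0..1} w"
  shows "(\<lambda>s. green_kernel \<beta> \<eta> t s * w s) integrable_on {0..1}"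
  by (intro integrable_continuous_real continuous_intros continuous_green_kernel assms) auto

text \<open>
  Replacing \<open>t\<close> by \<open>min 1 t\<close> extends functions on \<open>[-r,1]\<close> constantly to the right, so that the operator
  can be studied in the Banach space of bounded continuous functions on the whole line.
\<close>

definition hammerstein :: "(real \<Rightarrow> real) \<Rightarrow> real \<Rightarrow> real \<Rightarrow> real" where
  "hammerstein w q t = integral {0..1} (\<lambda>s. green_kernel \<beta> \<eta> (min 1 t) s * w s) + gamma_fn \<beta> \<eta> (min 1 t) * q"

lemma hammerstein_nonpos:
  assumes "t \<le> 0"
  shows "hammerstein w q t = 0"
proof -
  have "green_kernel \<beta> \<eta> t s = 0" if "s \<in> {0..1}" for s
    using assms that by (simp add: green_kernel_eq max_absorb1)
  then have "integral {0..1} (\<lambda>s. green_kernel \<beta> \<eta> t s * w s) = integral {0..1} (\<lambda>s::real. 0 :: real)"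
    by (intro integral_cong) simp
  then show ?thesis using assms by (simp add: hammerstein_def gamma_fn_eq min_absorb2)
qed

lemma hammerstein_gt_1: "t > 1 \<Longrightarrow> hammerstein w q t = hammerstein w q 1"
  by (simp add: hammerstein_def)

lemma gamma_bounds: "0 \<le> gamma_fn \<beta> \<eta> t" "gamma_fn \<beta> \<eta> (min 1 t) \<le> 1 / (\<beta> + \<eta>)"
  using \<beta> \<eta> by (auto simp: gamma_fn_eq intro!: divide_right_mono)

text \<open>The constant depends only on bounds for \<open>w\<close> and \<open>q\<close>; this is
  the equicontinuity behind the compactness of the operator.\<close>

lemma hammerstein_Lipschitz:
  assumes w: "continuous_on {0..1} w" "\<And>s. s \<in> {0..1} \<Longrightarrow> \<bar>w s\<bar> \<le> W" and q: "\<bar>q\<bar> \<le> q0"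
  shows "\<bar>hammerstein w q t - hammerstein w q t'\<bar> \<le> (2 * W + q0 / (\<beta> + \<eta>)) * \<bar>t - t'\<bar>"
proof -
  have tt: "\<bar>min 1 t - min 1 t'\<bar> \<le> \<bar>t - t'\<bar>" by linarith
  have "integral {0..1} (\<lambda>s. green_kernel \<beta> \<eta> (min 1 t) s * w s) - integral {0..1} (\<lambda>s. green_kernel \<beta> \<eta> (min 1 t') s * w s)
     = integral {0..1} (\<lambda>s. green_kernel \<beta> \<eta> (min 1 t) s * w s - green_kernel \<beta> \<eta> (min 1 t') s * w s)" (is "?I = _")
    by (intro integral_diff[symmetric] integrable_green w)
  also have "norm \<dots> \<le> integral {0..1} (\<lambda>s::real. (2 * \<bar>t - t'\<bar>) * W)"
  proof (rule integral_norm_bound_integral)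
    fix s :: real assume s: "s \<in> {0..1}"
    have "norm (green_kernel \<beta> \<eta> (min 1 t) s * w s - green_kernel \<beta> \<eta> (min 1 t') s * w s)
        = \<bar>green_kernel \<beta> \<eta> (min 1 t) s - green_kernel \<beta> \<eta> (min 1 t') s\<bar> * \<bar>w s\<bar>"
      by (simp add: abs_mult[symmetric] left_diff_distrib)
    also have "\<dots> \<le> (2 * \<bar>t - t'\<bar>) * W"
      using order_trans[OF green_kernel_Lipschitz[of s "min 1 t" "min 1 t'"]] tt s w(2)[OF s] by (intro mult_mono) auto
    finally show "norm (green_kernel \<beta> \<eta> (min 1 t) s * w s - green_kernel \<beta> \<eta> (min 1 t') s * w s) \<le> (2 * \<bar>t - t'\<bar>) * W" .
  qed (simp_all add: integrable_diff integrable_green w integrable_const_ivl)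
  also have "\<dots> = 2 * W * \<bar>t - t'\<bar>" by simp
  finally have 1: "\<bar>?I\<bar> \<le> 2 * W * \<bar>t - t'\<bar>" unfolding real_norm_def .
  have "\<bar>gamma_fn \<beta> \<eta> (min 1 t) * q - gamma_fn \<beta> \<eta> (min 1 t') * q\<bar>
      = \<bar>max 0 (min 1 t) - max 0 (min 1 t')\<bar> / (\<beta> + \<eta>) * \<bar>q\<bar>"
    using \<beta> \<eta> by (simp add: gamma_fn_eq left_diff_distrib[symmetric] diff_divide_distrib[symmetric] abs_mult)
  also have "\<dots> \<le> \<bar>t - t'\<bar> / (\<beta> + \<eta>) * q0"
    using \<beta> \<eta> q by (intro mult_mono divide_right_mono) auto
  finally have 2: "\<bar>gamma_fn \<beta> \<eta> (min 1 t) * q - gamma_fn \<beta> \<eta> (min 1 t') * q\<bar> \<le> q0 / (\<beta> + \<eta>) * \<bar>t - t'\<bar>"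
    by (simp add: algebra_simps)
  show ?thesis unfolding hammerstein_def distrib_right using 1 2 by linarith
qed

text \<open>The majorant \<open>M * s\<close> is independent of \<open>t\<close>, so this controls
  the supremum norm by the very quantity that appears in \<open>hammerstein_lower\<close>.\<close>

lemma hammerstein_bound:
  assumes w: "continuous_on {0..1} w" "\<And>s. s \<in> {0..1} \<Longrightarrow> w s \<ge> 0" and q: "q \<ge> 0"
  shows "\<bar>hammerstein w q t\<bar> \<le> M * integral {0..1} (\<lambda>s. s * w s) + q / (\<beta> + \<eta>)"
proof -
  have int: "(\<lambda>s. M * (s * w s)) integrable_on {0..1}"
    by (intro integrable_continuous_real continuous_intros w)
  have "norm (integral {0..1} (\<lambda>s. green_kernel \<beta> \<eta> (min 1 t) s * w s)) \<le> integral {0..1} (\<lambda>s. M * (s * w s))"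
  proof (intro integral_norm_bound_integral integrable_green w int)
    fix s :: real assume "s \<in> {0..1}"
    then show "norm (green_kernel \<beta> \<eta> (min 1 t) s * w s) \<le> M * (s * w s)"
      using mult_right_mono[OF green_kernel_bound[of s "min 1 t"] w(2)[of s]] w(2)[of s]
      by (simp add: abs_mult mult.assoc)
  qed
  moreover have "gamma_fn \<beta> \<eta> (min 1 t) * q \<le> 1 / (\<beta> + \<eta>) * q"
    using gamma_bounds q by (intro mult_right_mono) auto
  moreover have "0 \<le> gamma_fn \<beta> \<eta> (min 1 t) * q" using gamma_bounds q by simp
  ultimately show ?thesis by (simp add: hammerstein_def)
qed

text \<open>Both terms yield the factor \<open>c\<close>: the kernel dominates
  \<open>c * (M * s)\<close> on \<open>{a..b}\<close>, and \<open>c \<le> a \<le> t\<close> handles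
  the boundary term. Combined with \<open>hammerstein_bound\<close> this is the cone
  inequality.\<close>

lemma hammerstein_lower:
  assumes w: "continuous_on {0..1} w" "\<And>s. s \<in> {0..1} \<Longrightarrow> w s \<ge> 0" and q: "q \<ge> 0" and t: "t \<in> {a..b}"
  shows "c * (M * integral {0..1} (\<lambda>s. s * w s) + q / (\<beta> + \<eta>)) \<le> hammerstein w q t"
proof -
  have t': "min 1 t = t" using t b \<kappa>1 by auto
  have int: "(\<lambda>s. c * (M * (s * w s))) integrable_on {0..1}"
    by (intro integrable_continuous_real continuous_intros w)
  have "integral {0..1} (\<lambda>s. c * (M * (s * w s))) \<le> integral {0..1} (\<lambda>s. green_kernel \<beta> \<eta> t s * w s)"
  proof (intro integral_le integrable_green w int)
    fix s :: real assume "s \<in> {0..1}"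
    then show "c * (M * (s * w s)) \<le> green_kernel \<beta> \<eta> t s * w s"
      using mult_right_mono[OF green_kernel_lower[of s t] w(2)[of s]] t
      by (simp add: mult.assoc)
  qed
  moreover have "c * (q / (\<beta> + \<eta>)) \<le> gamma_fn \<beta> \<eta> t * q"
  proof -
    have "c * (q / (\<beta> + \<eta>)) \<le> t * (q / (\<beta> + \<eta>))"
      using c_le_a t q \<beta> \<eta> by (intro mult_right_mono) auto
    then show ?thesis using t a by (simp add: gamma_fn_eq)
  qed
  ultimately show ?thesis by (simp add: hammerstein_def t' distrib_left)
qed

lemma hammerstein_diff:
  assumes w: "continuous_on {0..1} w" and w': "continuous_on {0..1} w'"
    and d: "\<And>s. s \<in> {0..1} \<Longrightarrow> \<bar>w s - w' s\<bar> \<le> d"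
  shows "\<bar>hammerstein w q t - hammerstein w' q' t\<bar> \<le> M * d + \<bar>q - q'\<bar> / (\<beta> + \<eta>)"
proof -
  have "integral {0..1} (\<lambda>s. green_kernel \<beta> \<eta> (min 1 t) s * w s) - integral {0..1} (\<lambda>s. green_kernel \<beta> \<eta> (min 1 t) s * w' s)
     = integral {0..1} (\<lambda>s. green_kernel \<beta> \<eta> (min 1 t) s * w s - green_kernel \<beta> \<eta> (min 1 t) s * w' s)" (is "?I = _")
    by (intro integral_diff[symmetric] integrable_green w w')
  also have "norm \<dots> \<le> integral {0..1} (\<lambda>s::real. M * d)"
  proof (rule integral_norm_bound_integral)
    fix s :: real assume s: "s \<in> {0..1}"
    have "norm (green_kernel \<beta> \<eta> (min 1 t) s * w s - green_kernel \<beta> \<eta> (min 1 t) s * w' s)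
        = \<bar>green_kernel \<beta> \<eta> (min 1 t) s\<bar> * \<bar>w s - w' s\<bar>"
      by (simp add: abs_mult[symmetric] right_diff_distrib)
    also have "\<dots> \<le> (M * 1) * d"
      using order_trans[OF green_kernel_bound[of s "min 1 t"], of "M * 1"] s d[OF s] M1 by (intro mult_mono) auto
    finally show "norm (green_kernel \<beta> \<eta> (min 1 t) s * w s - green_kernel \<beta> \<eta> (min 1 t) s * w' s) \<le> M * d" by simp
  qed (simp_all add: integrable_diff integrable_green w w' integrable_const_ivl)
  also have "\<dots> = M * d" by simp
  finally have 1: "\<bar>?I\<bar> \<le> M * d" unfolding real_norm_def .
  have "\<bar>gamma_fn \<beta> \<eta> (min 1 t) * q - gamma_fn \<beta> \<eta> (min 1 t) * q'\<bar> = gamma_fn \<beta> \<eta> (min 1 t) * \<bar>q - q'\<bar>"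
    using gamma_bounds by (simp add: right_diff_distrib[symmetric] abs_mult)
  also have "\<dots> \<le> 1 / (\<beta> + \<eta>) * \<bar>q - q'\<bar>" using gamma_bounds by (intro mult_right_mono) auto
  finally have 2: "\<bar>gamma_fn \<beta> \<eta> (min 1 t) * q - gamma_fn \<beta> \<eta> (min 1 t) * q'\<bar> \<le> \<bar>q - q'\<bar> / (\<beta> + \<eta>)"
    by simp
  show ?thesis unfolding hammerstein_def using 1 2 by linarith
qed

section \<open>The cone in the space of bounded continuous functions\<close>

text \<open>\<open>Bcontfun\<close> yields the intended element only for bounded continuous
  functions; \<open>hammerstein_op_apply\<close> checks this for continuous nonnegative
  \<open>w\<close> and \<open>q \<ge> 0\<close>.\<close>

definition hammerstein_op :: "(real \<Rightarrow> real) \<Rightarrow> real \<Rightarrow> real \<Rightarrow>\<^sub>C real" where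
  "hammerstein_op w q = Bcontfun (hammerstein w q)"

text \<open>
  In \<open>cone\<close>, the condition for \<open>t > 1\<close> singles out the extended functions, for which the norm is the supremum
  over \<open>[0,1]\<close>.
\<close>

definition cone :: "(real \<Rightarrow>\<^sub>C real) set" where
  "cone = {g. (\<forall>t\<le>0. apply_bcontfun g t = 0) \<and> (\<forall>t>1. apply_bcontfun g t = apply_bcontfun g 1) \<and> (\<forall>t\<in>{a..b}. c * norm g \<le> apply_bcontfun g t)}"

lemma hammerstein_op_apply:
  assumes w: "continuous_on {0..1} w" "\<And>s. s \<in> {0..1} \<Longrightarrow> w s \<ge> 0" and q: "q \<ge> 0"
  shows "apply_bcontfun (hammerstein_op w q) = hammerstein w q"
proof -
  have "bounded (w ` {0..1})" by (intro compact_imp_bounded compact_continuous_image w) auto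
  then obtain W where W: "\<And>s. s \<in> {0..1} \<Longrightarrow> norm (w s) \<le> W"
    unfolding bounded_iff by blast
  have "continuous_on UNIV (hammerstein w q)"
  \<comment> \<open>The absolute value is taken because \<open>lipschitz_on\<close> asks for a
    nonnegative constant.\<close>
  proof (rule lipschitz_on_continuous_on[unfolded lipschitz_on_def, where L = "\<bar>2 * W + \<bar>q\<bar> / (\<beta> + \<eta>)\<bar>"], intro conjI ballI)
    fix t t'
    show "dist (hammerstein w q t) (hammerstein w q t') \<le> \<bar>2 * W + \<bar>q\<bar> / (\<beta> + \<eta>)\<bar> * dist t t'"
      using hammerstein_Lipschitz[OF w(1), of W q "\<bar>q\<bar>" t t'] W
        mult_right_mono[OF abs_ge_self[of "2 * W + \<bar>q\<bar> / (\<beta> + \<eta>)"], of "\<bar>t - t'\<bar>"]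
      by (simp add: dist_real_def)
  qed simp
  then have "hammerstein w q \<in> bcontfun"
    using hammerstein_bound[OF w q] by (intro bcontfun_normI) auto
  then show ?thesis by (simp add: hammerstein_op_def Bcontfun_inverse)
qed

lemma norm_hammerstein_op:
  assumes w: "continuous_on {0..1} w" "\<And>s. s \<in> {0..1} \<Longrightarrow> w s \<ge> 0" and q: "q \<ge> 0"
  shows "norm (hammerstein_op w q) \<le> M * integral {0..1} (\<lambda>s. s * w s) + q / (\<beta> + \<eta>)"
  by (rule norm_bound) (use hammerstein_op_apply[OF w q] hammerstein_bound[OF w q] in auto)

lemma hammerstein_op_in_cone:
  assumes w: "continuous_on {0..1} w" "\<And>s. s \<in> {0..1} \<Longrightarrow> w s \<ge> 0" and q: "q \<ge> 0"
  shows "hammerstein_op w q \<in> cone"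
proof -
  have "c * norm (hammerstein_op w q) \<le> hammerstein w q t" if "t \<in> {a..b}" for t
  proof -
    have "c * norm (hammerstein_op w q) \<le> c * (M * integral {0..1} (\<lambda>s. s * w s) + q / (\<beta> + \<eta>))"
      using norm_hammerstein_op[OF w q] c_pos by (intro mult_left_mono) auto
    then show ?thesis using hammerstein_lower[OF w q that] by linarith
  qed
  then show ?thesis unfolding cone_def using hammerstein_op_apply[OF w q] hammerstein_nonpos hammerstein_gt_1 by auto
qed

lemma cone_clamp:
  assumes "g \<in> cone"
  shows "g t = g (max 0 (min 1 t))"
proof -
  consider "t \<le> 0" | "0 \<le> t" "t \<le> 1" | "t > 1" by linarith
  then show ?thesis using assms by cases (auto simp: cone_def max_absorb1 max_absorb2 min_absorb1 min_absorb2)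
qed

lemma convex_cone: "convex cone"
proof (rule convexI)
  fix g h :: "real \<Rightarrow>\<^sub>C real" and u v :: real
  assume g: "g \<in> cone" and h: "h \<in> cone" and uv: "0 \<le> u" "0 \<le> v" "u + v = 1"
  have "c * norm (u *\<^sub>R g + v *\<^sub>R h) \<le> u * g t + v * h t" if t: "t \<in> {a..b}" for t
  proof -
    have "c * norm (u *\<^sub>R g + v *\<^sub>R h) \<le> c * (u * norm g + v * norm h)"
      using uv c_pos norm_triangle_ineq[of "u *\<^sub>R g" "v *\<^sub>R h"] by (intro mult_left_mono) auto
    also have "\<dots> = u * (c * norm g) + v * (c * norm h)" by (simp add: algebra_simps)
    also have "\<dots> \<le> u * g t + v * h t"
      using g h t uv by (intro add_mono mult_left_mono) (auto simp: cone_def)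
    finally show ?thesis .
  qed
  then show "u *\<^sub>R g + v *\<^sub>R h \<in> cone" using g h by (auto simp: cone_def)
qed

lemma cone_scale:
  assumes "g \<in> cone" "s \<ge> 0"
  shows "s *\<^sub>R g \<in> cone"
proof -
  have "c * norm (s *\<^sub>R g) \<le> s * g t" if "t \<in> {a..b}" for t
    using mult_left_mono[of "c * norm g" "g t" s] assms that by (auto simp: cone_def algebra_simps)
  then show ?thesis using assms by (auto simp: cone_def)
qed

text \<open>This provides the direction \<open>e\<close> of the retraction. With
  \<open>w = 0\<close> and \<open>q = 1\<close> the operator returns \<open>gamma_fn\<close>,
  continued constantly beyond 1; it is positive at \<open>a\<close>, where members of the cone
  cannot be negative.\<close>

lemma cone_pointed: "hammerstein_op (\<lambda>_. 0) 1 \<in> cone" "- hammerstein_op (\<lambda>_. 0) 1 \<notin> cone"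
proof -
  let ?e = "hammerstein_op (\<lambda>_. 0) 1"
  show "?e \<in> cone" by (rule hammerstein_op_in_cone) auto
  have "?e a = a / (\<beta> + \<eta>)"
    using a ab b \<kappa>1 by (subst hammerstein_op_apply) (auto simp: hammerstein_def gamma_fn_eq)
  then have "?e a > 0" using a \<beta> \<eta> by simp
  show "- ?e \<notin> cone"
  proof
    assume "- ?e \<in> cone"
    then have "c * norm (- ?e) \<le> - ?e a" using ab by (simp add: cone_def)
    moreover have "c * norm (- ?e) \<ge> 0" using c_pos by simp
    ultimately show False using \<open>?e a > 0\<close> by simp
  qed
qed

lemma closed_cone: "closed cone"
proof -
  have "cone = (\<Inter>t\<in>{..0}. {g. apply_bcontfun g t = 0}) \<inter> (\<Inter>t\<in>{1<..}. {g. apply_bcontfun g t = apply_bcontfun g 1}) \<inter> (\<Inter>t\<in>{a..b}. {g. c * norm g \<le> apply_bcontfun g t})"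
    by (auto simp: cone_def)
  also have "closed \<dots>"
    by (intro closed_Int closed_INT ballI closed_Collect_eq closed_Collect_le
        continuous_intros continuous_on_eval_bcontfun)
  finally show ?thesis .
qed

text \<open>Members of the cone satisfy the clamping condition of
  \<open>compact_equilipschitz\<close>, and every condition is closed since the norm and the point
  evaluations are continuous. This set will contain the values of \<open>F\<close> on the
  sphere.\<close>

lemma compact_cone_Lipschitz:
  "compact {g. g \<in> cone \<and> norm g \<le> P \<and> (\<forall>s t. \<bar>apply_bcontfun g s - apply_bcontfun g t\<bar> \<le> \<Lambda> * \<bar>s - t\<bar>)}"
proof (rule compact_equilipschitz[of _ P \<Lambda>])
  have "{g. g \<in> cone \<and> norm g \<le> P \<and> (\<forall>s t. \<bar>apply_bcontfun g s - apply_bcontfun g t\<bar> \<le> \<Lambda> * \<bar>s - t\<bar>)}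
      = cone \<inter> {g. norm g \<le> P} \<inter> (\<Inter>s. \<Inter>t. {g. \<bar>apply_bcontfun g s - apply_bcontfun g t\<bar> \<le> \<Lambda> * \<bar>s - t\<bar>})"
    by auto
  also have "closed \<dots>"
    by (intro closed_Int closed_INT ballI closed_Collect_eq closed_Collect_le closed_cone
        continuous_intros continuous_on_eval_bcontfun)
  finally show "closed {g. g \<in> cone \<and> norm g \<le> P \<and> (\<forall>s t. \<bar>apply_bcontfun g s - apply_bcontfun g t\<bar> \<le> \<Lambda> * \<bar>s - t\<bar>)}" .
qed (auto intro: cone_clamp)

text \<open>By clamping, all values of \<open>g\<close> on the line are taken on
  \<open>{0..1}\<close>. Asking \<open>u\<close> to agree with \<open>g\<close> only there covers
  restrictions to \<open>{-r..1}\<close> and other representatives.\<close>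

lemma supnorm_cone:
  assumes "g \<in> cone" "\<And>t. t \<in> {0..1} \<Longrightarrow> u t = g t"
  shows "supnorm {0..1} u = norm g"
proof -
  have eq: "(\<lambda>t. \<bar>u t\<bar>) ` {0..1} = (\<lambda>t. \<bar>g t\<bar>) ` {0..1}" using assms(2) by force
  have bdd: "bdd_above ((\<lambda>t. \<bar>g t\<bar>) ` {0..1})"
    using norm_bounded[of g] by (intro bdd_aboveI2[of _ _ "norm g"]) auto
  have "norm g \<le> (SUP t\<in>{0..1}. \<bar>g t\<bar>)"
  proof (rule norm_bound)
    fix t
    have "g t = g (max 0 (min 1 t))" using assms(1) by (rule cone_clamp)
    then show "norm (g t) \<le> (SUP t\<in>{0..1}. \<bar>g t\<bar>)"
      using cSUP_upper[OF _ bdd, of "max 0 (min 1 t)"] by simp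
  qed
  moreover have "(SUP t\<in>{0..1}. \<bar>g t\<bar>) \<le> norm g"
    using norm_bounded[of g] by (intro cSUP_least) auto
  ultimately show ?thesis by (simp add: supnorm_def eq)
qed

end

section \<open>The boundary value problem\<close>

locale bvp = bvp_kernel +
  fixes r \<rho> \<eta>\<rho> :: real
    and \<omega> \<sigma> \<delta>\<rho> :: "real \<Rightarrow> real"
    and f :: "real \<Rightarrow> real \<Rightarrow> real \<Rightarrow> real"
    and B :: "(real \<Rightarrow> real) \<Rightarrow> real"
  assumes r: "r \<ge> 0"
    and \<omega>: "continuous_on {-r..0} \<omega>"
    and f_cont: "continuous_on ({0..1} \<times> UNIV \<times> UNIV) (\<lambda>(t, x, y). f t x y)"
    and f_nonneg: "\<And>t x y. t \<in> {0..1} \<Longrightarrow> f t x y \<ge> 0"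
    and \<sigma>: "continuous_on {0..1} \<sigma>" "\<sigma> \<in> {0..1} \<rightarrow> {-r..1}"
    and \<rho>: "\<rho> > 0"
    and \<delta>_cont: "continuous_on {0..1} \<delta>\<rho>"
    and f_lower: "\<And>t x y. t \<in> {a..b} \<Longrightarrow>
           max \<bar>x\<bar> \<bar>y\<bar> \<le> \<rho> + supnorm {-r..1} (psi_fn \<beta> \<eta> \<omega>) \<Longrightarrow> f t x y \<ge> \<delta>\<rho> t"
    and B_cont: "continuous_map
           (subtopology (K\<psi>_topology r a b c \<beta> \<eta> \<omega>) (K\<psi>_closure r a b c \<beta> \<eta> \<omega> \<rho>)) euclideanreal B"
    and B_nonneg: "\<And>u. u \<in> K\<psi>_closure r a b c \<beta> \<eta> \<omega> \<rho> \<Longrightarrow> B u \<ge> 0"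
    and B_bounded: "bounded (B ` K\<psi>_closure r a b c \<beta> \<eta> \<omega> \<rho>)"
    and B_lower: "\<And>u. u \<in> K\<psi>_boundary r a b c \<beta> \<eta> \<omega> \<rho> \<Longrightarrow> B u \<ge> \<eta>\<rho>"
    and pos: "(SUP t\<in>{a..b}. gamma_fn \<beta> \<eta> t * \<eta>\<rho> + integral {a..b} (\<lambda>s. green_kernel \<beta> \<eta> t s * \<delta>\<rho> s)) > 0"
begin

section \<open>Translation of the cone by \<psi>\<close>

text \<open>This is the passage from the cone on the line to \<open>K\<psi>\<close>;
  \<open>restrict\<close> makes the result extensional, as points of \<open>C_space\<close> must
  be.\<close>

definition lift :: "(real \<Rightarrow>\<^sub>C real) \<Rightarrow> real \<Rightarrow> real" where
  "lift g = restrict (\<lambda>t. psi_fn \<beta> \<eta> \<omega> t + g t) {-r..1}"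

lemma psi_cont: "continuous_on {-r..1} (psi_fn \<beta> \<eta> \<omega>)"
proof -
  have "{t \<in> {-r..1}. t \<le> 0} = {-r..0}" by auto
  then show ?thesis
    unfolding psi_fn_def[abs_def] using \<omega> \<beta> \<eta>
    by (intro continuous_on_cases_le) (auto intro!: continuous_intros)
qed

lemma psi_bound:
  assumes "t \<in> {-r..1}"
  shows "\<bar>psi_fn \<beta> \<eta> \<omega> t\<bar> \<le> supnorm {-r..1} (psi_fn \<beta> \<eta> \<omega>)"
  unfolding supnorm_def
proof (rule cSUP_upper[OF assms])
  have "continuous_on {-r..1} (\<lambda>t. \<bar>psi_fn \<beta> \<eta> \<omega> t\<bar>)" by (intro continuous_intros psi_cont)
  then show "bdd_above ((\<lambda>t. \<bar>psi_fn \<beta> \<eta> \<omega> t\<bar>) ` {-r..1})"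
    by (intro bounded_imp_bdd_above compact_imp_bounded compact_continuous_image) auto
qed

lemma lift_cont: "continuous_on {-r..1} (lift g)"
proof -
  have "continuous_on {-r..1} (\<lambda>t. psi_fn \<beta> \<eta> \<omega> t + g t)" by (intro continuous_intros psi_cont) auto
  then show ?thesis by (rule continuous_on_eq) (simp add: lift_def)
qed

lemma lift_in_C_space: "lift g \<in> mspace (C_space {-r..1})"
  using lift_cont[of g] by (simp add: mspace_C_space) (simp add: lift_def)

lemma restrict_in_K0:
  assumes "g \<in> cone"
  shows "restrict g {-r..1} \<in> K0 r a b c"
proof -
  have "continuous_on {-r..1} (apply_bcontfun g)" by simp
  then have 1: "continuous_on {-r..1} (restrict g {-r..1})" by (rule continuous_on_eq) simp
  have 2: "supnorm {0..1} (restrict g {-r..1}) = norm g"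
    using r by (intro supnorm_cone assms) auto
  have "c * norm g \<le> (INF t\<in>{a..b}. restrict g {-r..1} t)"
    using assms r a ab b \<kappa>1 by (intro cINF_greatest) (auto simp: cone_def)
  then show ?thesis using 1 2 assms by (auto simp: K0_def mspace_C_space cone_def)
qed

lemma lift_eq: "lift g = restrict (\<lambda>t. psi_fn \<beta> \<eta> \<omega> t + restrict g {-r..1} t) {-r..1}"
  by (auto simp: lift_def restrict_def)

lemma lift_in_K\<psi>: "g \<in> cone \<Longrightarrow> lift g \<in> K\<psi> r a b c \<beta> \<eta> \<omega>"
  unfolding K\<psi>_def translate_on_def
  by (rule image_eqI[where x = "restrict g {-r..1}"]) (simp_all only: lift_eq restrict_in_K0)

lemma lift_in_ball_iff:
  assumes "g \<in> cone"
  shows "lift g \<in> K\<psi>_ball r a b c \<beta> \<eta> \<omega> \<rho> \<longleftrightarrow> norm g < \<rho>"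
proof
  have sn: "supnorm {0..1} (restrict g {-r..1}) = norm g"
    using r by (intro supnorm_cone assms) auto
  show "norm g < \<rho> \<Longrightarrow> lift g \<in> K\<psi>_ball r a b c \<beta> \<eta> \<omega> \<rho>"
    unfolding K\<psi>_ball_def K0_ball_def translate_on_def
    by (rule image_eqI[where x = "restrict g {-r..1}"]) (simp_all only: lift_eq restrict_in_K0[OF assms] sn mem_Collect_eq simp_thms)
  assume "lift g \<in> K\<psi>_ball r a b c \<beta> \<eta> \<omega> \<rho>"
  \<comment> \<open>The \<open>u\<close> from the image need not a priori be the restriction of
    \<open>g\<close>. Cancelling \<psi> pointwise gives agreement on \<open>{0..1}\<close>, which
    determines the norm.\<close>
  then obtain u where u: "supnorm {0..1} u < \<rho>"
    and eq: "lift g = restrict (\<lambda>t. psi_fn \<beta> \<eta> \<omega> t + u t) {-r..1}"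
    unfolding K\<psi>_ball_def K0_ball_def translate_on_def by blast
  have "u t = g t" if "t \<in> {0..1}" for t
    using fun_cong[OF eq, of t] that r by (simp add: lift_def)
  then show "norm g < \<rho>" using supnorm_cone[OF assms] u by metis
qed

text \<open>In a difference of two lifts \<psi> cancels, so \<open>lift\<close> is Lipschitz with
  constant 1.\<close>

lemma lift_continuous: "continuous_map (top_of_set cone) (K\<psi>_topology r a b c \<beta> \<eta> \<omega>) lift"
proof -
  have "mdist (C_space {-r..1}) (lift g) (lift h) \<le> 1 * dist g h" for g h
  proof -
    have "mdist (C_space {-r..1}) (lift g) (lift h) = supnorm {-r..1} (\<lambda>t. lift g t - lift h t)"
      using r by (intro mdist_C_space lift_in_C_space) auto
    also have "\<dots> \<le> dist g h"
      unfolding supnorm_def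
    proof (rule cSUP_least)
      fix t assume "t \<in> {-r..1}"
      then have "\<bar>lift g t - lift h t\<bar> = dist (g t) (h t)" by (simp add: lift_def dist_real_def)
      then show "\<bar>lift g t - lift h t\<bar> \<le> dist g h" using dist_bounded[of g t h] by simp
    qed (use r in auto)
    finally show ?thesis by simp
  qed
  then have "Lipschitz_continuous_map (submetric euclidean_metric cone) (C_space {-r..1}) lift"
    unfolding Lipschitz_continuous_map_def using lift_in_C_space
    by (intro conjI exI[of _ 1]) (auto simp del: mult_1)
  then have "continuous_map (top_of_set cone) (mtopology_of (C_space {-r..1})) lift"
    using Lipschitz_continuous_imp_continuous_map by (force simp: mtopology_of_submetric)
  then show ?thesis
    using lift_in_K\<psi> by (auto simp: K\<psi>_topology_def continuous_map_in_subtopology)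
qed

text \<open>Shrinking \<open>g\<close> by factors that tend to 1 from below stays in the cone and
  enters the open ball, so \<open>g\<close> is a limit of interior points; continuity of
  \<open>lift\<close> carries this over to \<open>K\<psi>\<close>.\<close>

lemma lift_in_closure:
  assumes "g \<in> cone" "norm g \<le> \<rho>"
  shows "lift g \<in> K\<psi>_closure r a b c \<beta> \<eta> \<omega> \<rho>"
proof -
  let ?S = "{g \<in> cone. norm g < \<rho>}"
  have "(\<lambda>n. (1 - inverse (real (Suc n))) *\<^sub>R g) \<longlonglongrightarrow> (1 - 0) *\<^sub>R g"
    by (intro tendsto_intros LIMSEQ_inverse_real_of_nat)
  moreover have "(1 - inverse (real (Suc n))) *\<^sub>R g \<in> ?S" for n
  proof -
    have t: "0 \<le> 1 - inverse (real (Suc n))" "1 - inverse (real (Suc n)) < 1"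
      by (auto simp: inverse_le_1_iff)
    have "(1 - inverse (real (Suc n))) * norm g < \<rho>"
    proof (cases "norm g = 0")
      case False
      then have "(1 - inverse (real (Suc n))) * norm g < 1 * norm g"
        using t by (intro mult_strict_right_mono) auto
      then show ?thesis using assms by simp
    qed (use \<rho> in simp)
    then show ?thesis using t cone_scale[OF assms(1)] by simp
  qed
  ultimately have "g \<in> closure ?S" unfolding closure_sequential
    by (intro exI[of _ "\<lambda>n. (1 - inverse (real (Suc n))) *\<^sub>R g"]) simp
  then have "g \<in> top_of_set cone closure_of ?S"
    using assms by (simp add: closure_of_subtopology Int_absorb1 Collect_conj_eq)
  then have "lift g \<in> K\<psi>_topology r a b c \<beta> \<eta> \<omega> closure_of (lift ` ?S)"
    using continuous_map_image_closure_subset[OF lift_continuous, of ?S] by auto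
  moreover have "lift ` ?S \<subseteq> K\<psi>_ball r a b c \<beta> \<eta> \<omega> \<rho>" using lift_in_ball_iff by auto
  ultimately show ?thesis unfolding K\<psi>_closure_def using closure_of_mono by blast
qed

text \<open>A point of norm exactly \<open>\<rho>\<close> is in the closure of the ball but not in
  the ball, hence also in the closure of the complement.\<close>

lemma lift_in_boundary:
  assumes "g \<in> cone" "norm g = \<rho>"
  shows "lift g \<in> K\<psi>_boundary r a b c \<beta> \<eta> \<omega> \<rho>"
proof -
  let ?X = "K\<psi>_topology r a b c \<beta> \<eta> \<omega>" and ?U = "K\<psi>_ball r a b c \<beta> \<eta> \<omega> \<rho>"
  have "lift g \<in> topspace ?X"
    using lift_continuous assms(1) by (auto simp: continuous_map_def)
  then have "lift g \<in> topspace ?X - ?U" using lift_in_ball_iff assms by simp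
  then have "lift g \<in> ?X closure_of (topspace ?X - ?U)" using closure_of_subset[of "topspace ?X - ?U" ?X] by auto
  then show ?thesis using lift_in_closure assms
    by (simp add: K\<psi>_boundary_def K\<psi>_closure_def frontier_of_closures)
qed

lemma B_lift_cont: "continuous_on {g \<in> cone. norm g = \<rho>} (\<lambda>g. B (lift g))"
proof -
  have "continuous_map (top_of_set {g \<in> cone. norm g = \<rho>})
      (subtopology (K\<psi>_topology r a b c \<beta> \<eta> \<omega>) (K\<psi>_closure r a b c \<beta> \<eta> \<omega> \<rho>)) lift"
    using continuous_map_from_subtopology_mono[OF lift_continuous, of "{g \<in> cone. norm g = \<rho>}"] lift_in_closure
    by (auto simp: continuous_map_in_subtopology)
  from continuous_map_compose[OF this B_cont] show ?thesis
    by (simp add: o_def)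
qed

section \<open>The nonlinearity along lifted functions\<close>

definition nemytskii :: "(real \<Rightarrow>\<^sub>C real) \<Rightarrow> real \<Rightarrow> real" where
  "nemytskii g s = f s (lift g s) (lift g (\<sigma> s))"

text \<open>This is the radius in \<open>f_lower\<close>. Lifts of functions of norm at most
  \<open>\<rho>\<close> take values in \<open>{-R..R}\<close>, so \<open>f\<close> is evaluated only
  on a compact box.\<close>

definition R where "R = \<rho> + supnorm {-r..1} (psi_fn \<beta> \<eta> \<omega>)"

lemma lift_bound:
  assumes "norm g \<le> \<rho>" "t \<in> {-r..1}"
  shows "\<bar>lift g t\<bar> \<le> R"
  using norm_bounded[of g t] psi_bound[OF assms(2)] assms by (simp add: lift_def R_def)

lemma nemytskii_cont: "continuous_on {0..1} (nemytskii g)"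
proof -
  have "continuous_on {0..1} (\<lambda>s. (s, lift g s, lift g (\<sigma> s)))"
    using r \<sigma> by (intro continuous_intros continuous_on_subset[OF lift_cont] continuous_on_compose2[OF lift_cont]) auto
  then have "continuous_on {0..1} ((\<lambda>(t, x, y). f t x y) \<circ> (\<lambda>s. (s, lift g s, lift g (\<sigma> s))))"
    by (intro continuous_on_compose continuous_on_subset[OF f_cont]) auto
  then show ?thesis by (simp add: o_def nemytskii_def[abs_def])
qed

lemma nemytskii_nonneg: "s \<in> {0..1} \<Longrightarrow> nemytskii g s \<ge> 0"
  by (simp add: nemytskii_def f_nonneg)

lemma nemytskii_args:
  assumes "norm g \<le> \<rho>" "s \<in> {0..1}"
  shows "(s, lift g s, lift g (\<sigma> s)) \<in> {0..1} \<times> {-R..R} \<times> {-R..R}"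
proof -
  have "s \<in> {-r..1}" "\<sigma> s \<in> {-r..1}" using assms r \<sigma> by auto
  then have "\<bar>lift g s\<bar> \<le> R" "\<bar>lift g (\<sigma> s)\<bar> \<le> R" using lift_bound assms by blast+
  then show ?thesis using assms by (auto simp: abs_le_iff)
qed

lemma f_cont_box: "continuous_on ({0..1} \<times> {-R..R} \<times> {-R..R}) (\<lambda>(t, x, y). f t x y)"
  by (rule continuous_on_subset[OF f_cont]) auto

lemma compact_box: "compact ({0..1::real} \<times> {-R..R} \<times> {-R..R})"
  by (intro compact_Times) auto

lemma nemytskii_bounded: "\<exists>W. \<forall>g s. norm g \<le> \<rho> \<longrightarrow> s \<in> {0..1} \<longrightarrow> \<bar>nemytskii g s\<bar> \<le> W"
proof -
  have "bounded ((\<lambda>(t, x, y). f t x y) ` ({0..1} \<times> {-R..R} \<times> {-R..R}))"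
    by (intro compact_imp_bounded compact_continuous_image f_cont_box compact_box)
  then obtain W where W: "\<And>p. p \<in> {0..1} \<times> {-R..R} \<times> {-R..R} \<Longrightarrow> norm ((\<lambda>(t, x, y). f t x y) p) \<le> W"
    unfolding bounded_iff by blast
  have "\<bar>nemytskii g s\<bar> \<le> W" if "norm g \<le> \<rho>" "s \<in> {0..1}" for g s
    using W[OF nemytskii_args[OF that]] by (simp add: nemytskii_def)
  then show ?thesis by blast
qed

text \<open>Uniform continuity of \<open>f\<close> on the box makes the estimate uniform in
  \<open>s\<close>. The values at \<open>s\<close> and at \<open>\<sigma> s\<close> each move by at
  most \<open>dist g h\<close>, whence the threshold \<open>d / 2\<close>.\<close>

lemma nemytskii_uniform:
  assumes "\<epsilon> > 0"
  shows "\<exists>d>0. \<forall>g h. norm g \<le> \<rho> \<longrightarrow> norm h \<le> \<rho> \<longrightarrow> dist g h < d \<longrightarrow> (\<forall>s\<in>{0..1}. \<bar>nemytskii g s - nemytskii h s\<bar> < \<epsilon>)"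
proof -
  have "uniformly_continuous_on ({0..1} \<times> {-R..R} \<times> {-R..R}) (\<lambda>(t, x, y). f t x y)"
    by (rule compact_uniformly_continuous[OF f_cont_box compact_box])
  then obtain d where d: "d > 0"
    "\<And>p q. p \<in> {0..1} \<times> {-R..R} \<times> {-R..R} \<Longrightarrow> q \<in> {0..1} \<times> {-R..R} \<times> {-R..R} \<Longrightarrow> dist q p < d
        \<Longrightarrow> dist ((\<lambda>(t, x, y). f t x y) q) ((\<lambda>(t, x, y). f t x y) p) < \<epsilon>"
    unfolding uniformly_continuous_on_def using assms by metis
  have "\<bar>nemytskii g s - nemytskii h s\<bar> < \<epsilon>"
    if g: "norm g \<le> \<rho>" and h: "norm h \<le> \<rho>" and dist: "dist g h < d / 2" and s: "s \<in> {0..1}" for g h s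
  proof -
    have le: "dist (lift g t) (lift h t) \<le> dist g h" if "t \<in> {-r..1}" for t
      using dist_bounded[of g t h] that by (simp add: lift_def dist_real_def)
    have "dist (s, lift g s, lift g (\<sigma> s)) (s, lift h s, lift h (\<sigma> s))
        \<le> dist (lift g s) (lift h s) + dist (lift g (\<sigma> s)) (lift h (\<sigma> s))"
      by (simp add: dist_Pair_Pair sqrt_sum_squares_le_sum)
    also have "\<dots> \<le> dist g h + dist g h" using s r \<sigma> by (intro add_mono le) auto
    also have "\<dots> < d" using dist by simp
    finally show ?thesis using d(2)[OF nemytskii_args[OF h s] nemytskii_args[OF g s]] by (simp add: nemytskii_def dist_real_def)
  qed
  then show ?thesis using d(1) by (intro exI[of _ "d / 2"]) auto
qed

section \<open>The operator on the sphere of the cone\<close>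

text \<open>For \<open>g\<close> in the cone of norm \<open>\<rho>\<close>, the equation
  \<open>g = lam *\<^sub>R F g\<close> is the integral equation for \<open>lift g\<close> with
  \<psi> subtracted.\<close>

definition F :: "(real \<Rightarrow>\<^sub>C real) \<Rightarrow> real \<Rightarrow>\<^sub>C real" where
  "F g = hammerstein_op (nemytskii g) (B (lift g))"

lemma F_apply:
  assumes "g \<in> cone" "norm g = \<rho>"
  shows "apply_bcontfun (F g) = hammerstein (nemytskii g) (B (lift g))"
  unfolding F_def using assms by (intro hammerstein_op_apply nemytskii_cont nemytskii_nonneg B_nonneg lift_in_closure) auto

lemma F_in_cone:
  assumes "g \<in> cone" "norm g = \<rho>"
  shows "F g \<in> cone"
  unfolding F_def using assms by (intro hammerstein_op_in_cone nemytskii_cont nemytskii_nonneg B_nonneg lift_in_closure) auto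

lemma F_cont: "continuous_on {g \<in> cone. norm g = \<rho>} F"
  unfolding continuous_on_iff
proof (intro ballI allI impI)
  fix g and \<epsilon> :: real
  assume g: "g \<in> {g \<in> cone. norm g = \<rho>}" and "\<epsilon> > 0"
  \<comment> \<open>With these choices \<open>M * e1\<close> and
    \<open>e2 / (\<beta> + \<eta>)\<close> both equal \<open>\<epsilon> / 3\<close>, so their sum is
    strictly below \<open>\<epsilon>\<close>.\<close>
  define e1 where "e1 = \<epsilon> / (3 * M)"
  define e2 where "e2 = \<epsilon> / 3 * (\<beta> + \<eta>)"
  have "M > 0" using M1 by simp
  have e: "e1 > 0" "e2 > 0" using \<open>\<epsilon> > 0\<close> M1 \<beta> \<eta> by (auto simp: e1_def e2_def)
  obtain d1 where d1: "d1 > 0"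
    "\<And>g h s. norm g \<le> \<rho> \<Longrightarrow> norm h \<le> \<rho> \<Longrightarrow> dist g h < d1 \<Longrightarrow> s\<in>{0..1} \<Longrightarrow> \<bar>nemytskii g s - nemytskii h s\<bar> < e1"
    using nemytskii_uniform[OF e(1)] by blast
  obtain d2 where d2: "d2 > 0"
    "\<And>h. h \<in> {g \<in> cone. norm g = \<rho>} \<Longrightarrow> dist h g < d2 \<Longrightarrow> dist (B (lift h)) (B (lift g)) < e2"
    using B_lift_cont[unfolded continuous_on_iff, rule_format, OF g e(2)] by blast
  have "dist (F h) (F g) < \<epsilon>" if h: "h \<in> {g \<in> cone. norm g = \<rho>}" and "dist h g < min d1 d2" for h
  proof -
    have "dist (F h) (F g) \<le> M * e1 + e2 / (\<beta> + \<eta>)"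
    proof (rule dist_bound)
      fix t
      have "\<bar>hammerstein (nemytskii h) (B (lift h)) t - hammerstein (nemytskii g) (B (lift g)) t\<bar>
          \<le> M * e1 + \<bar>B (lift h) - B (lift g)\<bar> / (\<beta> + \<eta>)"
        using d1(2)[of h g] g h that by (intro hammerstein_diff nemytskii_cont) (force intro: less_imp_le)
      also have "\<dots> \<le> M * e1 + e2 / (\<beta> + \<eta>)"
        using d2(2)[OF h] that(2) \<beta> \<eta>
        by (intro add_left_mono divide_right_mono) (auto simp: dist_real_def)
      finally show "dist (F h t) (F g t) \<le> M * e1 + e2 / (\<beta> + \<eta>)"
        using g h by (simp add: F_apply dist_real_def)
    qed
    also have "e2 / (\<beta> + \<eta>) = \<epsilon> / 3"
      unfolding e2_def by (rule nonzero_mult_div_cancel_right) (use \<beta> \<eta> in simp)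
    also have "M * e1 = \<epsilon> / 3" using \<open>M > 0\<close> by (simp add: e1_def)
    also have "\<epsilon> / 3 + \<epsilon> / 3 < \<epsilon>" using \<open>\<epsilon> > 0\<close> by simp
    finally show ?thesis .
  qed
  then show "\<exists>d>0. \<forall>h\<in>{g \<in> cone. norm g = \<rho>}. dist h g < d \<longrightarrow> dist (F h) (F g) < \<epsilon>"
    using d1(1) d2(1) by (intro exI[of _ "min d1 d2"]) auto
qed

text \<open>The bound \<open>W\<close> for \<open>f\<close> on the box and the bound
  \<open>q\<close> for \<open>B\<close> give one norm bound and one Lipschitz constant for all
  values of \<open>F\<close> on the sphere.\<close>

lemma F_compact: "\<exists>Q. compact Q \<and> Q \<subseteq> cone \<and> (\<forall>g\<in>cone. norm g = \<rho> \<longrightarrow> F g \<in> Q)"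
proof -
  obtain W where W: "\<And>g s. norm g \<le> \<rho> \<Longrightarrow> s \<in> {0..1} \<Longrightarrow> \<bar>nemytskii g s\<bar> \<le> W"
    using nemytskii_bounded by blast
  obtain q where q: "\<And>u. u \<in> K\<psi>_closure r a b c \<beta> \<eta> \<omega> \<rho> \<Longrightarrow> norm (B u) \<le> q"
    using B_bounded unfolding bounded_iff by blast
  define \<Lambda> where "\<Lambda> = 2 * W + q / (\<beta> + \<eta>)"
  define P where "P = M * W + q / (\<beta> + \<eta>)"
  let ?Q = "{g. g \<in> cone \<and> norm g \<le> P \<and> (\<forall>s t. \<bar>apply_bcontfun g s - apply_bcontfun g t\<bar> \<le> \<Lambda> * \<bar>s - t\<bar>)}"
  have "F g \<in> ?Q" if g: "g \<in> cone" "norm g = \<rho>" for g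
  proof -
    have cl: "lift g \<in> K\<psi>_closure r a b c \<beta> \<eta> \<omega> \<rho>" using lift_in_closure g by simp
    have "integral {0..1} (\<lambda>s. s * nemytskii g s) \<le> integral {0..1} (\<lambda>s::real. W)"
    proof (rule integral_le)
      show "(\<lambda>s. s * nemytskii g s) integrable_on {0..1}"
        by (intro integrable_continuous_real continuous_intros nemytskii_cont)
      fix s :: real assume s: "s \<in> {0..1}"
      then have "s * nemytskii g s \<le> 1 * W"
        using W[of g s] nemytskii_nonneg[of s g] g by (intro mult_mono) auto
      then show "s * nemytskii g s \<le> W" by simp
    qed auto
    then have "M * integral {0..1} (\<lambda>s. s * nemytskii g s) \<le> M * W" using M1 by (intro mult_left_mono) auto
    moreover have "B (lift g) / (\<beta> + \<eta>) \<le> q / (\<beta> + \<eta>)"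
      using q[OF cl] \<beta> \<eta> by (intro divide_right_mono) auto
    moreover have "norm (F g) \<le> M * integral {0..1} (\<lambda>s. s * nemytskii g s) + B (lift g) / (\<beta> + \<eta>)"
      unfolding F_def by (intro norm_hammerstein_op nemytskii_cont nemytskii_nonneg B_nonneg cl)
    ultimately have "norm (F g) \<le> P" by (simp add: P_def)
    moreover have "\<bar>F g s - F g t\<bar> \<le> \<Lambda> * \<bar>s - t\<bar>" for s t
      unfolding F_apply[OF g] \<Lambda>_def using W[of g] g q[OF cl]
      by (intro hammerstein_Lipschitz nemytskii_cont) auto
    ultimately show ?thesis using F_in_cone[OF g] by simp
  qed
  then show ?thesis using compact_cone_Lipschitz[of P \<Lambda>] by (intro exI[of _ ?Q]) auto
qed

text \<open>A positive supremum forces \<open>\<theta> t > 0\<close> at some \<open>t\<close> in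
  \<open>{a..b}\<close>. That \<open>t\<close> does not depend on \<open>g\<close>, and
  \<open>\<theta> t\<close> bounds \<open>F g t\<close>, hence the norm, from below on the whole
  sphere.\<close>

lemma F_lower: "\<exists>\<delta>>0. \<forall>g\<in>cone. norm g = \<rho> \<longrightarrow> \<delta> \<le> norm (F g)"
proof -
  define \<theta> where "\<theta> t = gamma_fn \<beta> \<eta> t * \<eta>\<rho> + integral {a..b} (\<lambda>s. green_kernel \<beta> \<eta> t s * \<delta>\<rho> s)" for t
  have "\<exists>t\<in>{a..b}. \<theta> t > 0"
  proof (rule ccontr)
    assume "\<not> ?thesis"
    then have "(SUP t\<in>{a..b}. \<theta> t) \<le> 0" using ab by (intro cSUP_least) (auto simp: not_less)
    then show False using pos by (simp add: \<theta>_def[abs_def])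
  qed
  then obtain t where t: "t \<in> {a..b}" "\<theta> t > 0" by blast
  have "\<theta> t \<le> norm (F g)" if g: "g \<in> cone" "norm g = \<rho>" for g
  proof -
    have sub: "{a..b} \<subseteq> {0..1}" using a b \<kappa>1 by auto
    have t1: "min 1 t = t" using t b \<kappa>1 by auto
    have int: "(\<lambda>s. green_kernel \<beta> \<eta> t s * nemytskii g s) integrable_on {a..b}"
      by (rule integrable_on_subinterval[OF integrable_green[OF nemytskii_cont] sub])
    have "integral {a..b} (\<lambda>s. green_kernel \<beta> \<eta> t s * \<delta>\<rho> s) \<le> integral {a..b} (\<lambda>s. green_kernel \<beta> \<eta> t s * nemytskii g s)"
    proof (rule integral_le[OF _ int])
      show "(\<lambda>s. green_kernel \<beta> \<eta> t s * \<delta>\<rho> s) integrable_on {a..b}"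
        by (rule integrable_on_subinterval[OF integrable_green[OF \<delta>_cont] sub])
      fix s assume s: "s \<in> {a..b}"
      then have "\<delta>\<rho> s \<le> nemytskii g s"
        unfolding nemytskii_def using nemytskii_args[of g s] g sub by (intro f_lower) (auto simp: R_def abs_le_iff)
      then show "green_kernel \<beta> \<eta> t s * \<delta>\<rho> s \<le> green_kernel \<beta> \<eta> t s * nemytskii g s"
        using s sub t by (intro mult_left_mono green_kernel_nonneg) auto
    qed
    \<comment> \<open>For this \<open>t\<close> in \<open>{a..b}\<close> the kernel is nonnegative
      for every \<open>s\<close> in \<open>{0..1}\<close>, so enlarging the domain cannot decrease
      the integral.\<close>
    also have "\<dots> \<le> integral {0..1} (\<lambda>s. green_kernel \<beta> \<eta> t s * nemytskii g s)"
      using t nemytskii_nonneg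
      by (intro integral_subset_le sub int integrable_green nemytskii_cont) (auto intro!: mult_nonneg_nonneg green_kernel_nonneg)
    moreover have "gamma_fn \<beta> \<eta> t * \<eta>\<rho> \<le> gamma_fn \<beta> \<eta> t * B (lift g)"
      using gamma_bounds B_lower[OF lift_in_boundary[OF g]] by (intro mult_left_mono)
    ultimately have "\<theta> t \<le> F g t" by (simp add: \<theta>_def F_apply[OF g] hammerstein_def t1)
    also have "\<dots> \<le> norm (F g)" using norm_bounded[of "F g" t] by simp
    finally show ?thesis .
  qed
  then show ?thesis using t by blast
qed

section \<open>From the eigenvector to the solution\<close>

lemma solution_on_boundary:
  "\<exists>lam > 0. \<exists>u \<in> K\<psi>_boundary r a b c \<beta> \<eta> \<omega> \<rho>. bvp_solution r \<beta> \<eta> \<omega> f \<sigma> B lam u"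
proof -
  obtain Q where Q: "compact Q" "Q \<subseteq> cone" "\<And>g. g \<in> cone \<Longrightarrow> norm g = \<rho> \<Longrightarrow> F g \<in> Q"
    using F_compact by blast
  obtain \<delta> where \<delta>: "\<delta> > 0" "\<And>g. g \<in> cone \<Longrightarrow> norm g = \<rho> \<Longrightarrow> \<delta> \<le> norm (F g)"
    using F_lower by blast
  obtain g lam where g: "g \<in> cone" "norm g = \<rho>" and "lam > 0" and eq: "g = lam *\<^sub>R F g"
    by (rule birkhoff_kellogg_cone[OF convex_cone cone_scale cone_pointed \<rho> F_cont Q(3) Q(2,1) \<delta>])
  have "bvp_solution r \<beta> \<eta> \<omega> f \<sigma> B lam (lift g)"
    unfolding bvp_solution_def
  proof (intro conjI ballI lift_in_C_space)
    fix t assume t: "t \<in> {-r..1}"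
    \<comment> \<open>Evaluating the eigenvector equation at \<open>t\<close> gives the integral
      equation, since \<open>min 1 t = t\<close> on \<open>{-r..1}\<close>.\<close>
    have "g t = lam * hammerstein (nemytskii g) (B (lift g)) t"
      using arg_cong[OF eq, of "\<lambda>g. apply_bcontfun g t"] by (simp add: F_apply[OF g])
    then show "lift g t = psi_fn \<beta> \<eta> \<omega> t
        + lam * (integral {0..1} (\<lambda>s. green_kernel \<beta> \<eta> t s * f s (lift g s) (lift g (\<sigma> s)))
                 + gamma_fn \<beta> \<eta> t * B (lift g))"
      using t by (subst lift_def) (simp add: hammerstein_def nemytskii_def)
  qed
  then show ?thesis using \<open>lam > 0\<close> lift_in_boundary[OF g] by blast
qed

end

theorem theorem3p2:
  fixes r \<beta> \<eta> a b c \<rho> \<eta>\<rho> :: real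
    and \<omega> \<sigma> \<delta>\<rho> :: "real \<Rightarrow> real"
    and f :: "real \<Rightarrow> real \<Rightarrow> real \<Rightarrow> real"
    and B :: "(real \<Rightarrow> real) \<Rightarrow> real"
  assumes "r \<ge> 0" and "\<beta> > 0" and "0 < \<eta>" and "\<eta> < 1" and "0 < \<beta> + \<eta>" and "\<beta> + \<eta> < 1"
    and "continuous_on {-r..0} \<omega>"
    and "continuous_on ({0..1} \<times> UNIV \<times> UNIV) (\<lambda>(t, x, y). f t x y)"
    and "\<And>t x y. t \<in> {0..1} \<Longrightarrow> f t x y \<ge> 0"
    and "continuous_on {0..1} \<sigma>" and "\<sigma> \<in> {0..1} \<rightarrow> {-r..1}"
    and "a \<le> b" and "{a..b} \<subseteq> {0<..<\<beta> + \<eta>}"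
    and "c = c1 \<beta> \<eta> a b"
    and "\<rho> > 0"
    and "continuous_on {0..1} \<delta>\<rho>" and "\<And>t. t \<in> {0..1} \<Longrightarrow> \<delta>\<rho> t \<ge> 0"
    and "\<And>t x y. t \<in> {a..b} \<Longrightarrow>
           max \<bar>x\<bar> \<bar>y\<bar> \<le> \<rho> + supnorm {-r..1} (psi_fn \<beta> \<eta> \<omega>) \<Longrightarrow> f t x y \<ge> \<delta>\<rho> t"
    and "continuous_map
           (subtopology (K\<psi>_topology r a b c \<beta> \<eta> \<omega>) (K\<psi>_closure r a b c \<beta> \<eta> \<omega> \<rho>)) euclideanreal B"
    and "\<And>u. u \<in> K\<psi>_closure r a b c \<beta> \<eta> \<omega> \<rho> \<Longrightarrow> B u \<ge> 0"
    and "bounded (B ` K\<psi>_closure r a b c \<beta> \<eta> \<omega> \<rho>)"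
    and "\<eta>\<rho> \<ge> 0"
    and "\<And>u. u \<in> K\<psi>_boundary r a b c \<beta> \<eta> \<omega> \<rho> \<Longrightarrow> B u \<ge> \<eta>\<rho>"
    and "(SUP t\<in>{a..b}. gamma_fn \<beta> \<eta> t * \<eta>\<rho> + integral {a..b} (\<lambda>s. green_kernel \<beta> \<eta> t s * \<delta>\<rho> s)) > 0"
  shows "\<exists>lam > 0. \<exists>u \<in> K\<psi>_boundary r a b c \<beta> \<eta> \<omega> \<rho>. bvp_solution r \<beta> \<eta> \<omega> f \<sigma> B lam u"
proof -
  \<comment> \<open>As the interval is nonempty, the inclusion applies to both endpoints and yields
    the strict inequalities \<open>a > 0\<close> and \<open>b < \<beta> + \<eta>\<close> of the
    locale.\<close>
  have "a \<in> {0<..<\<beta> + \<eta>}" "b \<in> {0<..<\<beta> + \<eta>}" using assms by auto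
  then interpret bvp \<beta> \<eta> a b c r \<rho> \<eta>\<rho> \<omega> \<sigma> \<delta>\<rho> f B
    by unfold_locales (use assms in auto)
  show ?thesis by (rule solution_on_boundary)
qed

end
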